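(* Let $\mathfrak Q$ be an $\mathscr F$-Boltzmann map (with parameter $q$) and $\mathsf Q$ an $\mathscr F$-stopping map for $\mathfrak Q$. Then $\mathfrak Q$ can be decomposed as $$\mathfrak Q=\mathsf Q\odot(\mathfrak Q^{\mathsf Q}_h)_{h\in H(\mathsf Q)},$$ where, conditionally on $\mathcal F_{\mathsf Q}$, $(\mathfrak Q^{\mathsf Q}_h)_{h\in H(\mathsf Q)}$ is a collection of independent $q$-Boltzmann maps with boundary $h$ (i.e. perimeter $\deg h$) for every $h\in H(\mathsf Q)$.
   Context: A planar map is a finite connected graph properly embedded in the sphere with a distinguished oriented edge (the root edge). Each edge consists of two semi-edges, one per side. The root face is the face to the right of the root edge; its degree is the perimeter. A quadrangulation with boundary is a planar map in which all faces, except possibly the root face, are surrounded by 4 semi-edges; $\mathcal Q^\ell$ denotes those of perimeter $2\ell$, and $|F(\mathfrak q)|$ the number of interior (non-root) faces. A quadrangulation with holes is a planar map with boundary which has distinguished faces, called holes, which need not be squares, each one with a marked oriented edge, all non-distinguished interior faces being surrounded by 4 semi-edges. $H(\mathfrak q)$ is the set of holes of $\mathfrak q$, and $\mathcal Q_H$ the set of quadrangulations with holes. Gluing: given $\mathfrak q$ with holes and, for each $h\in H(\mathfrak q)$, a map $\mathfrak u_h$ (possibly with holes) of perimeter $\deg h$, the map $\mathfrak q\odot(\mathfrak u_h)_{h}$ is obtained by identifying, for each $h$, the root edge of $\mathfrak u_h$ with the marked edge of $h$ and then, following the orientation, the edges of the boundary of $\mathfrak u_h$ with the edges of $h$; it keeps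 the root and boundary of $\mathfrak q$. Write $\mathfrak q\subset\mathfrak p$ if $\mathfrak p=\mathfrak q\odot(\mathfrak u_h)_h$ for some collection $(\mathfrak u_h)_h$, which is then uniquely defined and denoted $(\mathfrak p^{\mathfrak q}_h)_h$. There is a minimal element for this relation, the empty map $\dagger$ (cemetery), with $\dagger\subset\mathfrak q$ for all $\mathfrak q\in\mathcal Q_H$. $q$-Boltzmann map with half-perimeter $\ell$ ($q>0$): random element of $\mathcal Q^\ell$ with $\mathbb P(\mathfrak Q=\mathfrak q)=q^{|F(\mathfrak q)|}/W_q^\ell$, $W_q^\ell<\infty$ the normalising constant. A filtration is a collection of $\sigma$-algebras $\mathscr F=(\mathcal F_{\mathfrak q})_{\mathfrak q\in\mathcal Q_H}$, complete with respect to $\mathbb P$, with $\mathcal F_{\mathfrak q_1}\subseteq\mathcal F_{\mathfrak q_2}$ whenever $\mathfrak q_1\subset\mathfrak q_2$. A Boltzmann map $\mathfrak Q$ is an $\mathscr F$-Boltzmann map if for every $\mathfrak q\in\mathcal Q_H$: the event $\{\mathfrak q\subset\mathfrak Q\}$ is $\mathcal F_{\mathfrak q}$-measurable; and conditionally on $\mathcal F_{\mathfrak q}$ and on the event $\{\mathfrak q\subset\mathfrak Q\}$, $(\mathfrak Q^{\mathfrak q}_h)_{h\in H(\mathfrak q)}$ is a collection of independent $q$-Boltzmann maps with boundary $h$ for every $h\in H(\mathfrak q)$. A random planar map with holes $\mathsf Q$ is an $\mathscr F$-stopping map for $\mathfrak Q$ if almost surely $\mathsf Q\subset\mathfrak Q$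 and $\{\mathsf Q\subset\mathfrak q\}\in\mathcal F_{\mathfrak q}$ for any $\mathfrak q\in\mathcal Q_H$. Its $\sigma$-algebra is $$\mathcal F_{\mathsf Q}=\Big\{\Theta\in\bigvee_{\mathfrak q\in\mathcal Q_H}\mathcal F_{\mathfrak q}:\ \Theta\cap\{\mathsf Q\subset\mathfrak q\}\in\mathcal F_{\mathfrak q}\ \text{for any }\mathfrak q\in\mathcal Q_H\Big\}.$$
   Formalization: Maps with holes are restricted to those where every filling yields a planar map and no edge borders holes on both sides; in the inclusion relation, a hole filled by a bare cycle must keep its marked edge (otherwise inclusion is not antisymmetric and the claim fails). *)

theory Defs
  imports "HOL-Probability.Probability" "HOL-Combinatorics.Orbits"
begin

text \<open>
  Planar maps are encoded by their semi-edges (darts). A dart is an oriented edge and stands for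
  the semi-edge on its right-hand side: \<open>opp\<close> reverses the orientation, and \<open>nxt d\<close> is the
  oriented edge that follows \<open>d\<close> on the contour of the face to the right of \<open>d\<close>. Faces are the
  orbits of \<open>nxt\<close>. Since \<open>nxt d\<close> and \<open>opp d\<close> both start at the end point of \<open>d\<close>, the vertices are
  the orbits of \<open>nxt \<circ> opp\<close>.

  \<open>marks\<close> contains one dart \<open>h\<close> in each hole, namely the semi-edge of the hole at its marked edge.
  The hole lies to the right of \<open>h\<close>; the marked oriented edge, along which the root edge of the
  filling is glued, is \<open>opp h\<close>: it has the hole, hence the inside of the filling, on its left,
  as the root edge of the filling has. Holes are named by these darts.
\<close>

record 'd hmap =
  darts :: "'d set"
  opp :: "'d \<Rightarrow> 'd"
  nxt :: "'d \<Rightarrow> 'd"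
  rootd :: 'd
  marks :: "'d set"

definition face :: "'d hmap \<Rightarrow> 'd \<Rightarrow> 'd set" where
  "face m d = orbit (nxt m) d"

definition faces :: "'d hmap \<Rightarrow> 'd set set" where
  "faces m = face m ` darts m"

definition edges :: "'d hmap \<Rightarrow> 'd set set" where
  "edges m = orbit (opp m) ` darts m"

definition vertices :: "'d hmap \<Rightarrow> 'd set set" where
  "vertices m = orbit (nxt m \<circ> opp m) ` darts m"

definition root_face :: "'d hmap \<Rightarrow> 'd set" where
  "root_face m = face m (rootd m)"

definition perimeter :: "'d hmap \<Rightarrow> nat" where
  "perimeter m = card (root_face m)"

definition hole_darts :: "'d hmap \<Rightarrow> 'd set" where
  "hole_darts m = (\<Union>h\<in>marks m. face m h)"

text \<open>Among connected maps, those on the sphere are singled out by Euler's relation.\<close>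

definition planar_map :: "'d hmap \<Rightarrow> bool" where
  "planar_map m \<longleftrightarrow>
     finite (darts m) \<and> rootd m \<in> darts m \<and>
     (\<forall>d\<in>darts m. opp m d \<in> darts m \<and> opp m d \<noteq> d \<and> opp m (opp m d) = d) \<and>
     bij_betw (nxt m) (darts m) (darts m) \<and>
     (\<forall>d\<in>darts m. (rootd m, d) \<in> {(a, b). a \<in> darts m \<and> (b = opp m a \<or> b = nxt m a)}\<^sup>*) \<and>
     card (vertices m) + card (faces m) = card (edges m) + 2"

text \<open>
  Maps are considered up to isomorphisms preserving the root and the marked edges of the holes;
  \<open>canon\<close> selects a representative of each class, with natural numbers as darts.
\<close>

definition map_iso :: "'d hmap \<Rightarrow> 'e hmap \<Rightarrow> bool" where
  "map_iso m m' \<longleftrightarrow> (\<exists>f. bij_betw f (darts m) (darts m') \<and>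
     (\<forall>d\<in>darts m. f (opp m d) = opp m' (f d) \<and> f (nxt m d) = nxt m' (f d)) \<and>
     f (rootd m) = rootd m' \<and> f ` marks m = marks m')"

definition canon :: "'d hmap \<Rightarrow> nat hmap" where
  "canon m = (SOME m'. map_iso m m')"

text \<open>
  Gluing \<open>u h\<close> into the hole \<open>h\<close>. Numbering the contour of the hole as
  \<open>d\<^sub>j = nxt\<^sup>j h\<close> and the contour of the root face of \<open>u h\<close> as \<open>e\<^sub>j = nxt\<^sup>j root\<close>, with \<open>j\<close> modulo the
  common degree, the oriented edge \<open>e\<^sub>j\<close> is identified with the reversal of \<open>d\<^sub>-\<^sub>j\<close>. The functions
  \<open>to_fill\<close> and \<open>to_hole\<close> send \<open>d\<^sub>-\<^sub>j\<close> to \<open>e\<^sub>j\<close> and \<open>e\<^sub>j\<close> to \<open>d\<^sub>-\<^sub>j\<close>. Both darts disappear, and their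
  opposites become the two semi-edges of one edge. If the opposite of \<open>e\<^sub>j\<close> is itself on the root
  face of \<open>u h\<close> (whose boundary need not be simple), then the gluing identifies two edges of the
  hole, and one has to go on to the opposite of the dart matched with it. This ends here, because
  in the maps below no edge has holes on both sides.
\<close>

definition to_fill :: "'d hmap \<Rightarrow> 'd \<Rightarrow> 'e hmap \<Rightarrow> 'd \<Rightarrow> 'e" where
  "to_fill m h u d = (nxt u ^^ (LEAST j. (nxt m ^^ j) d = h)) (rootd u)"

definition to_hole :: "'d hmap \<Rightarrow> 'd \<Rightarrow> 'e hmap \<Rightarrow> 'e \<Rightarrow> 'd" where
  "to_hole m h u e = (nxt m ^^ (LEAST j. (nxt u ^^ j) e = rootd u)) h"

definition hole_of :: "'d hmap \<Rightarrow> 'd \<Rightarrow> 'd" where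
  "hole_of m d = (THE h. h \<in> marks m \<and> d \<in> face m h)"

definition leave_fill :: "'d hmap \<Rightarrow> ('d \<Rightarrow> 'e hmap) \<Rightarrow> 'd \<Rightarrow> 'e \<Rightarrow> 'd + 'd \<times> 'e" where
  "leave_fill m u h e =
     (if e \<in> root_face (u h) then Inl (opp m (to_hole m h (u h) e)) else Inr (h, e))"

definition glue :: "'d hmap \<Rightarrow> ('d \<Rightarrow> 'e hmap) \<Rightarrow> ('d + 'd \<times> 'e) hmap" where
  "glue m u = \<lparr>
     darts = Inl ` (darts m - hole_darts m) \<union>
             Inr ` (SIGMA h:marks m. darts (u h) - root_face (u h)),
     opp = (\<lambda>x. case x of
         Inl d \<Rightarrow>
           (if opp m d \<in> hole_darts m
            then (let h = hole_of m (opp m d)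
                  in leave_fill m u h (opp (u h) (to_fill m h (u h) (opp m d))))
            else Inl (opp m d))
       | Inr (h, e) \<Rightarrow> leave_fill m u h (opp (u h) e)),
     nxt = (\<lambda>x. case x of Inl d \<Rightarrow> Inl (nxt m d) | Inr (h, e) \<Rightarrow> Inr (h, nxt (u h) e)),
     rootd = Inl (rootd m),
     marks = Inr ` (SIGMA h:marks m. marks (u h))\<rparr>"

text \<open>
  The last two conditions delimit the maps with holes for which gluing makes sense. Without
  the last one, gluing need not produce a planar map: if a hole visits a vertex twice and the
  filling has a cut vertex at the same two corners, the sphere is pinched off. It amounts to the
  holes having simple boundaries and touching each other, if at all, in a tree-like fashion.
  If an edge had holes on both sides, part of one filling could be moved into the other,
  and the fillings would not be determined by the glued map.
\<close>

definition quadrangulation_with_holes :: "nat hmap \<Rightarrow> bool" where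
  "quadrangulation_with_holes m \<longleftrightarrow>
     planar_map m \<and> marks m \<subseteq> darts m \<and> inj_on (face m) (marks m) \<and> rootd m \<notin> hole_darts m \<and>
     (\<forall>d\<in>darts m - root_face m - hole_darts m. card (face m d) = 4) \<and>
     (\<forall>d\<in>hole_darts m. opp m d \<notin> hole_darts m) \<and>
     (\<forall>u :: nat \<Rightarrow> nat hmap.
        (\<forall>h\<in>marks m. planar_map (u h) \<and> perimeter (u h) = card (face m h)) \<longrightarrow>
        planar_map (glue m u))"

definition QHmaps :: "nat hmap set" where
  "QHmaps = {m. quadrangulation_with_holes m \<and> canon m = m}"

text \<open>Quadrangulations with boundary, of perimeter \<open>2 * l\<close>; the root face may have any boundary.\<close>

definition Qb :: "nat \<Rightarrow> nat hmap set" where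
  "Qb l = {m \<in> QHmaps. marks m = {} \<and> perimeter m = 2 * l}"

definition inner_faces :: "'d hmap \<Rightarrow> 'd set set" where
  "inner_faces m = faces m - {root_face m}"

text \<open>
  The empty map \<open>Cemetery\<close> is given one formal hole, without prescribed degree, in which a whole
  map is inserted.
\<close>

datatype hqmap = Cemetery | Map "nat hmap"

definition QH :: "hqmap set" where
  "QH = insert Cemetery (Map ` QHmaps)"

fun holes :: "hqmap \<Rightarrow> nat set" where
  "holes Cemetery = {0}"
| "holes (Map m) = marks m"

fun glue_at :: "hqmap \<Rightarrow> (nat \<Rightarrow> nat hmap) \<Rightarrow> nat hmap" (infixl "\<odot>" 70) where
  "Cemetery \<odot> u = u 0"
| "Map m \<odot> u = canon (glue m u)"

text \<open>
  A filling that is just a cycle around a hole leaves the hole as it is; it is then required to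
  keep the marked edge of the hole. Otherwise maps that differ only in the marked edges of
  their holes would be contained in each other, and a stopping map could choose these edges
  by looking at what is inside the holes.
\<close>

definition keeps_mark :: "nat hmap \<Rightarrow> bool" where
  "keeps_mark u \<longleftrightarrow> (\<forall>h\<in>marks u. opp u ` root_face u = face u h \<longrightarrow> opp u h = rootd u)"

fun fills :: "hqmap \<Rightarrow> nat \<Rightarrow> nat hmap \<Rightarrow> bool" where
  "fills Cemetery h v \<longleftrightarrow> v \<in> QHmaps"
| "fills (Map m) h v \<longleftrightarrow> v \<in> QHmaps \<and> perimeter v = card (face m h) \<and> keeps_mark v"

definition filling :: "hqmap \<Rightarrow> (nat \<Rightarrow> nat hmap) \<Rightarrow> nat hmap \<Rightarrow> bool" where
  "filling x u p \<longleftrightarrow>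
     (\<forall>h\<in>holes x. fills x h (u h)) \<and> (\<forall>h. h \<notin> holes x \<longrightarrow> u h = undefined) \<and> p = x \<odot> u"

fun submap :: "hqmap \<Rightarrow> hqmap \<Rightarrow> bool" (infix "\<preceq>" 50) where
  "x \<preceq> Cemetery \<longleftrightarrow> x = Cemetery"
| "x \<preceq> Map p \<longleftrightarrow> (\<exists>u. filling x u p)"

text \<open>The collection of the fillings, unique when \<open>x \<preceq> Map p\<close>.\<close>

definition fillings :: "hqmap \<Rightarrow> nat hmap \<Rightarrow> nat \<Rightarrow> nat hmap" where
  "fillings x p = (SOME u. filling x u p)"

definition boltzmann_const :: "real \<Rightarrow> nat \<Rightarrow> real" where
  "boltzmann_const q l = (\<Sum>\<^sub>\<infinity>m\<in>Qb l. q ^ card (inner_faces m))"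

definition boltzmann :: "real \<Rightarrow> nat \<Rightarrow> nat hmap pmf" where
  "boltzmann q l =
     embed_pmf (\<lambda>m. if m \<in> Qb l then q ^ card (inner_faces m) / boltzmann_const q l else 0)"

text \<open>
  The law of independent Boltzmann maps in the holes of a submap of a map of perimeter \<open>2 * l\<close>.
  Holes of such submaps have even degree.
\<close>

fun boltzmann_family :: "real \<Rightarrow> nat \<Rightarrow> hqmap \<Rightarrow> (nat \<Rightarrow> nat hmap) pmf" where
  "boltzmann_family q l Cemetery = Pi_pmf {0} undefined (\<lambda>_. boltzmann q l)"
| "boltzmann_family q l (Map m) =
     Pi_pmf (marks m) undefined (\<lambda>h. boltzmann q (card (face m h) div 2))"

definition map_filtration :: "'a measure \<Rightarrow> (hqmap \<Rightarrow> 'a measure) \<Rightarrow> bool" where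
  "map_filtration M F \<longleftrightarrow>
     (\<forall>x\<in>QH. subalgebra M (F x) \<and> (\<forall>N\<in>null_sets M. \<forall>A\<subseteq>N. A \<in> sets (F x))) \<and>
     (\<forall>x\<in>QH. \<forall>y\<in>QH. x \<preceq> y \<longrightarrow> sets (F x) \<subseteq> sets (F y))"

definition boltzmann_map :: "'a measure \<Rightarrow> real \<Rightarrow> nat \<Rightarrow> ('a \<Rightarrow> nat hmap) \<Rightarrow> bool" where
  "boltzmann_map M q l Q \<longleftrightarrow>
     Q \<in> measurable M (count_space UNIV) \<and> (\<forall>\<omega>\<in>space M. Q \<omega> \<in> Qb l) \<and>
     distr M (count_space UNIV) Q = measure_pmf (boltzmann q l)"

definition filtered_boltzmann_map ::
  "'a measure \<Rightarrow> (hqmap \<Rightarrow> 'a measure) \<Rightarrow> real \<Rightarrow> nat \<Rightarrow> ('a \<Rightarrow> nat hmap) \<Rightarrow> bool" where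
  "filtered_boltzmann_map M F q l Q \<longleftrightarrow>
     boltzmann_map M q l Q \<and>
     (\<forall>x\<in>QH. {\<omega>\<in>space M. x \<preceq> Map (Q \<omega>)} \<in> sets (F x) \<and>
        (\<forall>B. AE \<omega> in M. x \<preceq> Map (Q \<omega>) \<longrightarrow>
           real_cond_exp M (F x) (indicator {\<omega>\<in>space M. fillings x (Q \<omega>) \<in> B}) \<omega> =
           measure_pmf.prob (boltzmann_family q l x) B))"

definition stopping_map ::
  "'a measure \<Rightarrow> (hqmap \<Rightarrow> 'a measure) \<Rightarrow> ('a \<Rightarrow> nat hmap) \<Rightarrow> ('a \<Rightarrow> hqmap) \<Rightarrow> bool" where
  "stopping_map M F Q S \<longleftrightarrow>
     S \<in> measurable M (count_space UNIV) \<and> (\<forall>\<omega>\<in>space M. S \<omega> \<in> QH) \<and>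
     (AE \<omega> in M. S \<omega> \<preceq> Map (Q \<omega>)) \<and>
     (\<forall>x\<in>QH. {\<omega>\<in>space M. S \<omega> \<preceq> x} \<in> sets (F x))"

definition stopped_events ::
  "'a measure \<Rightarrow> (hqmap \<Rightarrow> 'a measure) \<Rightarrow> ('a \<Rightarrow> hqmap) \<Rightarrow> 'a set set" where
  "stopped_events M F S =
     {\<Theta> \<in> sigma_sets (space M) (\<Union>x\<in>QH. sets (F x)).
        \<forall>x\<in>QH. \<Theta> \<inter> {\<omega>\<in>space M. S \<omega> \<preceq> x} \<in> sets (F x)}"

text \<open>For a stopping map the events above already form a sigma-algebra.\<close>

definition stopped_algebra ::
  "'a measure \<Rightarrow> (hqmap \<Rightarrow> 'a measure) \<Rightarrow> ('a \<Rightarrow> hqmap) \<Rightarrow> 'a measure" where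
  "stopped_algebra M F S = sigma (space M) (stopped_events M F S)"

end

(*
  There are countably many maps with holes, and inclusion is reflexive and antisymmetric on them,
  so {S = x} is {S <= x} minus the countable union of the {S <= y} with y < x. Hence {S = x}
  belongs to F x, and on this event the stopped algebra has the same trace as F x, so that the
  property of the Boltzmann map at the deterministic map x carries over to S.

  Inclusion is reflexive since a hole may be filled with a ring, the map whose two faces have the
  same simple contour. Antisymmetry comes from counting semi-edges and holes: mutual inclusion
  leaves only fillings in which all semi-edges off the root face lie in one hole, and Euler's
  relation then makes them rings.
*)

theory Submission
  imports Defs
begin

section \<open>Orbits\<close>

text \<open>Since \<open>canon\<close> is an arbitrary choice in each isomorphism class, an equality
  of maps has to come from an explicit bijection of semi-edges. Two bijections involve rings. Rings
  put into the holes of a map give the map back, which yields reflexivity. A map put into a ring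
  gives itself back, even when its boundary is not simple; this makes a ring a legitimate map with
  holes, as the definition demands a planar result for every planar filling of the right perimeter.
  Euler's relation enters antisymmetry as follows. If the opposites of the root-face semi-edges are
  exactly the semi-edges of a single hole and there are no others, there are two faces and as many
  edges as the perimeter, hence as many vertices. Turning around a vertex alternates between the two
  faces, so each vertex meets the root face, and the count leaves it one semi-edge there and one in
  the hole. The contour is therefore simple; the marked edge, which no count can see, is fixed by
  \<open>keeps_mark\<close>.\<close>

lemma orbit_self_in:
  assumes "finite D" "bij_betw g D D" "x \<in> D"
  shows "x \<in> orbit g x"
proof -
  \<comment> \<open>\<open>g\<close> is controlled on \<open>D\<close> only;
    \<open>perm_restrict g D\<close> is the identity elsewhere, hence a permutation of the whole
    type with the same orbit through \<open>x\<close>.\<close>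
  have "orbit g x = orbit (perm_restrict g D) x"
    using assms by (intro orbit_cong0[of _ D]) (auto simp: perm_restrict_def bij_betw_def)
  moreover have "perm_restrict g D permutes D"
    using assms by (intro bij_imp_permutes)
      (auto simp: perm_restrict_def cong: bij_betw_cong)
  then have "x \<in> orbit (perm_restrict g D) x"
    using assms(1) by (intro permutation_self_in_orbit) (auto simp: permutation_permutes)
  ultimately show ?thesis by simp
qed

lemma orbit_subset_closed:
  assumes "g ` D \<subseteq> D" "x \<in> D"
  shows "orbit g x \<subseteq> D"
proof
  fix y assume "y \<in> orbit g x" then show "y \<in> D" by induct (use assms in auto)
qed

lemma orbit_eq_if_in:
  assumes "x \<in> orbit g x" "y \<in> orbit g x"
  shows "orbit g y = orbit g x"
  using assms by (meson orbit_cyclic_eq3 cyclic_on_def)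

lemma orbit_involution:
  assumes "g (g x) = x"
  shows "orbit g x = {x, g x}"
proof
  show "orbit g x \<subseteq> {x, g x}" using assms by (intro orbit_subset_closed) auto
  show "{x, g x} \<subseteq> orbit g x" using orbit.base[of g x] orbit.step[of "g x" g x] assms by auto
qed

lemma funpow_card_orbit:
  assumes "x \<in> orbit g x"
  shows "(g ^^ card (orbit g x)) x = x" "0 < card (orbit g x)"
proof -
  let ?n = "funpow_dist1 g x x"
  have "inj_on (\<lambda>n. (g ^^ n) x) {0..<?n}"
    using assms by (rule inj_on_funpow_dist1)
  then have "card (orbit g x) = ?n"
    by (subst orbit_conv_funpow_dist1[OF assms]) (simp add: card_image)
  then show "(g ^^ card (orbit g x)) x = x" "0 < card (orbit g x)"
    using funpow_dist1_prop[OF assms] by simp_all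
qed

lemma funpow_orbit_mod:
  assumes "x \<in> orbit g x"
  shows "(g ^^ (n mod card (orbit g x))) x = (g ^^ n) x"
  using funpow_card_orbit(1)[OF assms] by (rule funpow_mod_eq)

text \<open>The iterates over one period are distinct, so positions on a contour are indexed by
  exponents modulo its degree. This makes the \<open>LEAST\<close> in \<open>to_fill\<close> and
  \<open>to_hole\<close> a harmless choice.\<close>

lemma funpow_eq_iff_mod:
  assumes "x \<in> orbit g x"
  shows "(g ^^ a) x = (g ^^ b) x \<longleftrightarrow> a mod card (orbit g x) = b mod card (orbit g x)"
proof -
  let ?n = "funpow_dist1 g x x" and ?p = "card (orbit g x)"
  have inj: "inj_on (\<lambda>n. (g ^^ n) x) {0..<?n}"
    using assms by (rule inj_on_funpow_dist1)
  then have "?p = ?n"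
    by (subst orbit_conv_funpow_dist1[OF assms]) (simp add: card_image)
  with funpow_card_orbit(2)[OF assms] have "a mod ?p \<in> {0..<?n}" "b mod ?p \<in> {0..<?n}" by simp_all
  from inj_on_eq_iff[OF inj this]
  have "(g ^^ (a mod ?p)) x = (g ^^ (b mod ?p)) x \<longleftrightarrow> a mod ?p = b mod ?p" .
  then show ?thesis by (simp add: funpow_orbit_mod[OF assms])
qed

lemma orbit_return:
  assumes "x \<in> orbit g x" "y \<in> orbit g x"
  obtains j where "(g ^^ j) y = x"
  using orbit_swap[OF assms] by (auto simp: orbit_altdef)

lemma orbit_image_commute:
  assumes "\<And>e. g' (f e) = f (g e)"
  shows "orbit g' (f e) = f ` orbit g e"
proof -
  have "(g' ^^ n) (f e) = f ((g ^^ n) e)" for n by (induct n) (simp_all add: assms)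
  then show ?thesis by (auto simp: orbit_altdef)
qed

text \<open>Applied to \<open>nxt \<circ> opp\<close>, \<open>opp\<close> and \<open>nxt\<close>,
  this carries the three terms of Euler's relation through an isomorphism.\<close>

lemma card_orbit_images:
  assumes "inj_on f D" "g ` D \<subseteq> D" "\<And>d. d \<in> D \<Longrightarrow> d \<in> orbit g d"
    and "\<And>d. d \<in> D \<Longrightarrow> g' (f d) = f (g d)"
  shows "card (orbit g' ` f ` D) = card (orbit g ` D)"
proof -
  have eq: "orbit g' (f d) = f ` orbit g d" if "d \<in> D" for d
    using orbit_inverse[of d g g' f] orbit_subset_closed[OF assms(2) that] assms(3,4) that by blast
  have "orbit g' ` f ` D = (`) f ` orbit g ` D"
    using eq by (auto simp: image_image intro!: image_cong)
  moreover have "inj_on ((`) f) (orbit g ` D)"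
  proof (rule inj_onI)
    fix X Y assume "X \<in> orbit g ` D" "Y \<in> orbit g ` D" and "f ` X = f ` Y"
    moreover from this have "X \<subseteq> D" "Y \<subseteq> D" using orbit_subset_closed[OF assms(2)] by blast+
    ultimately show "X = Y" using inj_on_image_eq_iff[OF assms(1)] by blast
  qed
  ultimately show ?thesis by (simp add: card_image)
qed

section \<open>Isomorphisms and canonical representatives\<close>

lemma planar_mapD:
  assumes "planar_map m"
  shows "finite (darts m)" "rootd m \<in> darts m" "bij_betw (nxt m) (darts m) (darts m)"
    and "d \<in> darts m \<Longrightarrow> opp m d \<in> darts m" "d \<in> darts m \<Longrightarrow> opp m d \<noteq> d"
    and "d \<in> darts m \<Longrightarrow> opp m (opp m d) = d" "d \<in> darts m \<Longrightarrow> nxt m d \<in> darts m"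
    and "card (vertices m) + card (faces m) = card (edges m) + 2"
  using assms unfolding planar_map_def by (auto dest: bij_betwE)

lemma map_iso_trans:
  assumes "map_iso a b" "map_iso b c"
  shows "map_iso a c"
proof -
  obtain f where f: "bij_betw f (darts a) (darts b)"
    "\<And>d. d \<in> darts a \<Longrightarrow> f (opp a d) = opp b (f d) \<and> f (nxt a d) = nxt b (f d)"
    "f (rootd a) = rootd b" "f ` marks a = marks b"
    using assms(1) unfolding map_iso_def by blast
  obtain g where g: "bij_betw g (darts b) (darts c)"
    "\<And>d. d \<in> darts b \<Longrightarrow> g (opp b d) = opp c (g d) \<and> g (nxt b d) = nxt c (g d)"
    "g (rootd b) = rootd c" "g ` marks b = marks c"
    using assms(2) unfolding map_iso_def by blast
  show ?thesis unfolding map_iso_def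
    using f g bij_betw_trans[OF f(1) g(1)] bij_betwE[OF f(1)]
    by (intro exI[of _ "g \<circ> f"]) (simp flip: f(4) g(4) add: image_comp)
qed

text \<open>An isomorphism is constrained on darts only. Inverting it needs \<open>opp\<close> and
  \<open>nxt\<close> to stay within the darts, which planarity gives, and the marks to be darts, so
  that \<open>inv_into\<close> finds them again.\<close>

lemma map_iso_sym:
  assumes "map_iso a b" "planar_map a" "marks a \<subseteq> darts a"
  shows "map_iso b a"
proof -
  obtain f where f: "bij_betw f (darts a) (darts b)"
    "\<And>d. d \<in> darts a \<Longrightarrow> f (opp a d) = opp b (f d) \<and> f (nxt a d) = nxt b (f d)"
    "f (rootd a) = rootd b" "f ` marks a = marks b"
    using assms(1) unfolding map_iso_def by blast
  let ?g = "inv_into (darts a) f"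
  have gf: "?g (f d) = d" if "d \<in> darts a" for d
    using that f(1) by (simp add: bij_betw_inv_into_left)
  note pm = planar_mapD[OF assms(2)]
  have comm: "?g (opp b e) = opp a (?g e) \<and> ?g (nxt b e) = nxt a (?g e)" if e: "e \<in> darts b" for e
  proof -
    obtain d where d: "d \<in> darts a" "e = f d"
      using e bij_betw_imp_surj_on[OF f(1)] by blast
    have "opp b e = f (opp a d)" "nxt b e = f (nxt a d)" using f(2)[OF d(1)] d(2) by simp_all
    then show ?thesis using d gf pm(4,7) by simp
  qed
  have "?g ` marks b = (\<lambda>d. d) ` marks a" unfolding f(4)[symmetric] image_image
    using gf assms(3) by (intro image_cong) auto
  then have "?g ` marks b = marks a" by simp
  moreover have "?g (rootd b) = rootd a" using f(3) gf[OF pm(2)] by simp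
  ultimately show ?thesis unfolding map_iso_def
    using comm bij_betw_inv_into[OF f(1)] by (intro exI[of _ ?g]) auto
qed

text \<open>Isomorphic maps have the same isomorphic candidates, so the choice operator is applied
  to the same predicate.\<close>

lemma canon_cong:
  assumes "map_iso a b" "planar_map a" "marks a \<subseteq> darts a"
  shows "canon a = canon b"
proof -
  have "map_iso a c \<longleftrightarrow> map_iso b c" for c :: "nat hmap"
    using map_iso_trans[OF map_iso_sym[OF assms]] map_iso_trans[OF assms(1)] by blast
  then show ?thesis unfolding canon_def by presburger
qed

text \<open>Outside its darts a map may carry arbitrary values of \<open>opp\<close> and
  \<open>nxt\<close>, so the record type is uncountable. Finite tables leave countably many maps,
  and each isomorphism class contains one of them.\<close>

definition map_of_code :: "nat \<times> nat list \<times> nat list \<times> nat \<times> nat list \<Rightarrow> nat hmap" where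
  "map_of_code = (\<lambda>(n, os, ns, r, ms).
     \<lparr>darts = {..<n}, opp = (!) os, nxt = (!) ns, rootd = r, marks = set ms\<rparr>)"

lemma map_iso_code:
  assumes "planar_map a" "marks a \<subseteq> darts a"
  obtains c where "map_iso a (map_of_code c)"
proof -
  note pm = planar_mapD[OF assms(1)]
  obtain f where f: "bij_betw f (darts a) {..<card (darts a)}"
    using ex_bij_betw_finite_nat[OF pm(1)] by (auto simp: atLeast0LessThan)
  let ?n = "card (darts a)" and ?g = "inv_into (darts a) f"
  obtain ms where ms: "set ms = f ` marks a"
    using finite_list[of "f ` marks a"] finite_subset[OF assms(2) pm(1)] by blast
  let ?c = "(?n, map (\<lambda>i. f (opp a (?g i))) [0..<?n], map (\<lambda>i. f (nxt a (?g i))) [0..<?n],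
             f (rootd a), ms)"
  have "map_iso a (map_of_code ?c)" unfolding map_iso_def
  proof (intro exI[of _ f] conjI ballI)
    fix d assume d: "d \<in> darts a"
    then have "f d < ?n" "?g (f d) = d" using f by (auto simp: bij_betw_inv_into_left dest: bij_betwE)
    then show "f (opp a d) = opp (map_of_code ?c) (f d)" "f (nxt a d) = nxt (map_of_code ?c) (f d)"
      by (simp_all add: map_of_code_def)
  qed (use f ms in \<open>simp_all add: map_of_code_def\<close>)
  then show ?thesis by (rule that)
qed

lemma map_iso_canon:
  assumes "planar_map a" "marks a \<subseteq> darts a"
  shows "map_iso a (canon a)"
  unfolding canon_def using map_iso_code[OF assms] by (metis someI_ex)

lemma QHmapsD:
  assumes "m \<in> QHmaps"
  shows "quadrangulation_with_holes m" "planar_map m" "marks m \<subseteq> darts m" "canon m = m"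
    and "rootd m \<notin> hole_darts m"
  using assms by (auto simp: QHmaps_def quadrangulation_with_holes_def)

lemma countable_QH: "countable QH"
proof -
  have "QHmaps \<subseteq> range (\<lambda>c. canon (map_of_code c))"
  proof
    fix m assume m: "m \<in> QHmaps"
    obtain c where "map_iso m (map_of_code c)"
      using map_iso_code[OF QHmapsD(2,3)[OF m]] .
    then have "canon (map_of_code c) = m"
      using canon_cong[OF _ QHmapsD(2,3)[OF m]] QHmapsD(4)[OF m] by metis
    then show "m \<in> range (\<lambda>c. canon (map_of_code c))" by (metis rangeI)
  qed
  then have "countable QHmaps" by (rule countable_subset) simp
  then show ?thesis unfolding QH_def by simp
qed

section \<open>Faces, and invariance of planarity under isomorphism\<close>

lemma face_self:
  assumes "planar_map m" "d \<in> darts m"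
  shows "d \<in> face m d" "face m d \<subseteq> darts m" "finite (face m d)"
proof -
  note pm = planar_mapD[OF assms(1)]
  show "d \<in> face m d" unfolding face_def using orbit_self_in[OF pm(1,3) assms(2)] .
  show s: "face m d \<subseteq> darts m" unfolding face_def
    using orbit_subset_closed[of "nxt m" "darts m" d] pm(7) assms(2) by blast
  show "finite (face m d)" using s pm(1) finite_subset by blast
qed

lemma root_face_subset:
  assumes "planar_map m"
  shows "rootd m \<in> root_face m" "root_face m \<subseteq> darts m" "finite (root_face m)"
  unfolding root_face_def using face_self[OF assms planar_mapD(2)[OF assms]] by auto

lemma face_eq:
  assumes "planar_map m" "d \<in> darts m" "e \<in> face m d"
  shows "face m e = face m d"
  using face_self[OF assms(1,2)] assms(3) unfolding face_def by (intro orbit_eq_if_in) auto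

lemma nxt_in_face_iff:
  assumes "planar_map m" "d \<in> darts m" "e \<in> darts m"
  shows "nxt m e \<in> face m d \<longleftrightarrow> e \<in> face m d"
proof -
  have e: "e \<in> face m e" "nxt m e \<in> face m e"
    using face_self[OF assms(1,3)] by (auto simp: face_def orbit.base)
  have "e \<in> face m d" if "nxt m e \<in> face m d"
    using face_eq[OF assms(1,3) e(2)] face_eq[OF assms(1,2) that] e by simp
  moreover have "nxt m e \<in> face m d" if "e \<in> face m d"
    using that unfolding face_def by (rule orbit.step)
  ultimately show ?thesis by blast
qed

lemma bij_nxt_opp:
  assumes "planar_map m"
  shows "bij_betw (nxt m \<circ> opp m) (darts m) (darts m)"
proof -
  note pm = planar_mapD[OF assms]
  have "bij_betw (opp m) (darts m) (darts m)"
    using pm(4,6) by (intro bij_betw_byWitness[where f' = "opp m"]) auto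
  then show ?thesis using pm(3) bij_betw_trans by blast
qed

lemma iso_face:
  assumes "planar_map a" "\<And>d. d \<in> darts a \<Longrightarrow> f (nxt a d) = nxt b (f d)" "d \<in> darts a"
  shows "face b (f d) = f ` face a d"
  using orbit_inverse[of d "nxt a" "nxt b" f] face_self[OF assms(1,3)] assms(2)
  unfolding face_def by (metis subsetD)

lemma planar_map_iso:
  assumes "map_iso a b" "planar_map a"
  shows "planar_map b"
proof -
  obtain f where f: "bij_betw f (darts a) (darts b)"
    "\<And>d. d \<in> darts a \<Longrightarrow> f (opp a d) = opp b (f d)"
    "\<And>d. d \<in> darts a \<Longrightarrow> f (nxt a d) = nxt b (f d)"
    "f (rootd a) = rootd b"
    using assms(1) unfolding map_iso_def by blast
  note pm = planar_mapD[OF assms(2)]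
  have D: "f ` darts a = darts b" and inj: "inj_on f (darts a)" using f(1) by (auto simp: bij_betw_def)
  have opp: "opp b (f d) = f (opp a d)" if "d \<in> darts a" for d using f(2) that by simp
  have nxt: "nxt b (f d) = f (nxt a d)" if "d \<in> darts a" for d using f(3) that by simp
  have bop: "bij_betw (opp a) (darts a) (darts a)"
    using pm(4,6) by (intro bij_betw_byWitness[where f' = "opp a"]) auto
  have "card (vertices b) = card (vertices a)" unfolding vertices_def D[symmetric]
    using pm orbit_self_in[OF pm(1) bij_nxt_opp[OF assms(2)]]
    by (intro card_orbit_images[OF inj]) (auto simp: opp nxt)
  moreover have "card (edges b) = card (edges a)" unfolding edges_def D[symmetric]
    using pm orbit_self_in[OF pm(1) bop]
    by (intro card_orbit_images[OF inj]) (auto simp: opp)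
  moreover have "card (faces b) = card (faces a)" unfolding faces_def face_def D[symmetric]
    using pm orbit_self_in[OF pm(1,3)]
    by (intro card_orbit_images[OF inj]) (auto simp: nxt)
  ultimately have "card (vertices b) + card (faces b) = card (edges b) + 2" using pm(8) by simp
  moreover have "bij_betw (nxt b) (darts b) (darts b)"
  proof (rule eq_card_imp_inj_on[THEN bij_betw_imageI])
    show "finite (darts b)" using pm(1) unfolding D[symmetric] by (rule finite_imageI)
    have "nxt b ` darts b = f ` nxt a ` darts a" unfolding D[symmetric] image_image
      by (rule image_cong) (simp_all add: nxt)
    also have "\<dots> = darts b" using pm(3) D by (simp add: bij_betw_def)
    finally show "nxt b ` darts b = darts b" "card (nxt b ` darts b) = card (darts b)" by simp_all
  qed
  moreover have "\<forall>e\<in>darts b. opp b e \<in> darts b \<and> opp b e \<noteq> e \<and> opp b (opp b e) = e"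
    unfolding D[symmetric] using pm(4-6) inj by (auto simp: opp inj_on_eq_iff)
  moreover have "(rootd b, f d) \<in> {(x, y). x \<in> darts b \<and> (y = opp b x \<or> y = nxt b x)}\<^sup>*"
    if "d \<in> darts a" for d
  proof -
    have "(rootd a, d) \<in> {(x, y). x \<in> darts a \<and> (y = opp a x \<or> y = nxt a x)}\<^sup>*"
      using assms(2) that by (auto simp: planar_map_def)
    then show ?thesis
    proof (induction rule: rtrancl_induct)
      case (step y z)
      then have "(f y, f z) \<in> {(x, y). x \<in> darts b \<and> (y = opp b x \<or> y = nxt b x)}"
        using D by (auto simp: opp nxt)
      with step.IH show ?case by (rule rtrancl_into_rtrancl)
    qed (simp add: f(4))
  qed
  then have "\<forall>e\<in>darts b. (rootd b, e) \<in> {(x, y). x \<in> darts b \<and> (y = opp b x \<or> y = nxt b x)}\<^sup>*"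
    unfolding D[symmetric] by (intro ballI) (elim imageE, simp only:)
  moreover have "finite (darts b)" using pm(1) unfolding D[symmetric] by (rule finite_imageI)
  moreover have "rootd b \<in> darts b" using imageI[OF pm(2), of f] D f(4) by simp
  ultimately show ?thesis unfolding planar_map_def by (intro conjI)
qed

section \<open>Gluing along a hole\<close>

text \<open>
  The functions \<open>to_fill\<close> and \<open>to_hole\<close> are the same construction with the two contours exchanged.
\<close>

definition reverse_match :: "('d \<Rightarrow> 'd) \<Rightarrow> 'd \<Rightarrow> ('e \<Rightarrow> 'e) \<Rightarrow> 'e \<Rightarrow> 'd \<Rightarrow> 'e" where
  "reverse_match g x k y d = (k ^^ (LEAST j. (g ^^ j) d = x)) y"

lemma to_fill_reverse_match: "to_fill m h u = reverse_match (nxt m) h (nxt u) (rootd u)"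
  by (simp add: fun_eq_iff to_fill_def reverse_match_def)

lemma to_hole_reverse_match: "to_hole m h u = reverse_match (nxt u) (rootd u) (nxt m) h"
  by (simp add: fun_eq_iff to_hole_def reverse_match_def)

text \<open>Two contours of the same degree, traversed in opposite senses: the match of
  \<open>d\<close> is reached from \<open>y\<close> in as many steps as \<open>d\<close> needs to
  get to \<open>x\<close>.\<close>

locale matched_orbits =
  fixes g :: "'d \<Rightarrow> 'd" and x :: 'd and k :: "'e \<Rightarrow> 'e" and y :: 'e
  assumes x: "x \<in> orbit g x" and y: "y \<in> orbit k y" and card_eq: "card (orbit g x) = card (orbit k y)"
begin

text \<open>Any number of steps to \<open>x\<close> may replace the least one, because on both
  contours exponents count modulo the common degree.\<close>

lemma reverse_match_eq:
  assumes "d \<in> orbit g x" "(g ^^ j) d = x"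
  shows "reverse_match g x k y d = (k ^^ j) y"
proof -
  let ?i = "LEAST j. (g ^^ j) d = x"
  have d: "orbit g d = orbit g x" "d \<in> orbit g d"
    using orbit_eq_if_in[OF x assms(1)] assms(1) by simp_all
  have "(g ^^ ?i) d = x" using assms(2) by (rule LeastI)
  then have "(g ^^ ?i) d = (g ^^ j) d" using assms(2) by simp
  then have "?i mod card (orbit k y) = j mod card (orbit k y)"
    using funpow_eq_iff_mod[OF d(2)] d(1) card_eq by simp
  then show ?thesis unfolding reverse_match_def using funpow_eq_iff_mod[OF y] by blast
qed

lemma reverse_match_base: "reverse_match g x k y x = y"
  using reverse_match_eq[of x 0] x by simp

lemma reverse_match_in: "reverse_match g x k y d \<in> orbit k y"
  unfolding reverse_match_def using y by (rule funpow_in_orbit)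

text \<open>\<open>g d\<close> is one step closer to \<open>x\<close>, so its match lies one
  \<open>k\<close>-step earlier: matching reverses the orientation.\<close>

lemma reverse_match_step:
  assumes d: "d \<in> orbit g x"
  shows "k (reverse_match g x k y (g d)) = reverse_match g x k y d"
proof -
  have gd: "g d \<in> orbit g x" using d by (rule orbit.step)
  obtain j where j: "(g ^^ j) (g d) = x" using orbit_return[OF x gd] .
  then have j': "(g ^^ Suc j) d = x" by (simp add: funpow_swap1)
  show ?thesis using reverse_match_eq[OF d j'] reverse_match_eq[OF gd j] by simp
qed

text \<open>If \<open>d\<close> is \<open>j\<close> steps before \<open>x\<close>, its match is
  \<open>j\<close> steps after \<open>y\<close>, hence \<open>?p - j\<close> steps before
  \<open>y\<close>, and matching back gives the point \<open>?p - j\<close> steps after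
  \<open>x\<close>, which is \<open>d\<close>. Reducing \<open>j\<close> modulo \<open>?p\<close>
  makes the subtraction meaningful.\<close>

lemma reverse_match_inverse:
  assumes d: "d \<in> orbit g x"
  shows "reverse_match k y g x (reverse_match g x k y d) = d"
proof -
  interpret rev: matched_orbits k y g x using x y card_eq by unfold_locales simp_all
  let ?p = "card (orbit k y)"
  have self: "d \<in> orbit g d" and p: "card (orbit g d) = ?p"
    using orbit_eq_if_in[OF x d] d card_eq by simp_all
  obtain j' where j': "(g ^^ j') d = x" using orbit_return[OF x d] .
  define j where "j = j' mod ?p"
  have "(g ^^ j) d = (g ^^ j') d"
    using funpow_orbit_mod[OF self, of j'] p unfolding j_def by simp
  then have j: "(g ^^ j) d = x" using j' by simp
  have "j < ?p" unfolding j_def using funpow_card_orbit(2)[OF y] by simp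
  have e: "reverse_match g x k y d = (k ^^ j) y" using reverse_match_eq[OF d j] .
  have "(k ^^ (?p - j)) ((k ^^ j) y) = (k ^^ ?p) y"
    using funpow_add[of "?p - j" j k] \<open>j < ?p\<close> by simp
  also have "\<dots> = y" using funpow_card_orbit(1)[OF y] .
  finally have "reverse_match k y g x ((k ^^ j) y) = (g ^^ (?p - j)) x"
    using rev.reverse_match_eq funpow_in_orbit[OF y] by blast
  also have "\<dots> = (g ^^ (?p - j)) ((g ^^ j) d)" using j by simp
  also have "\<dots> = (g ^^ ?p) d"
    using funpow_add[of "?p - j" j g] \<open>j < ?p\<close> by simp
  also have "\<dots> = d" using funpow_card_orbit(1)[OF self] p by simp
  finally show ?thesis using e by simp
qed

end

locale hole_filling =
  fixes m :: "'d hmap" and h :: 'd and u :: "'e hmap"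
  assumes m: "planar_map m" and h: "h \<in> darts m" and u: "planar_map u"
    and perim: "perimeter u = card (face m h)"
begin

sublocale fill: matched_orbits "nxt m" h "nxt u" "rootd u"
  using face_self(1)[OF m h] root_face_subset(1)[OF u] perim
  by unfold_locales (simp_all add: face_def root_face_def perimeter_def)

sublocale hole: matched_orbits "nxt u" "rootd u" "nxt m" h
  using fill.x fill.y fill.card_eq by unfold_locales simp_all

lemma to_fill_mark: "to_fill m h u h = rootd u"
  and to_fill_in: "to_fill m h u d \<in> root_face u"
  and nxt_to_fill: "d \<in> face m h \<Longrightarrow> nxt u (to_fill m h u (nxt m d)) = to_fill m h u d"
  and to_hole_to_fill: "d \<in> face m h \<Longrightarrow> to_hole m h u (to_fill m h u d) = d"
  using fill.reverse_match_base fill.reverse_match_in fill.reverse_match_step fill.reverse_match_inverse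
  unfolding to_fill_reverse_match to_hole_reverse_match face_def root_face_def by blast+

lemma to_hole_root: "to_hole m h u (rootd u) = h"
  and to_hole_in: "to_hole m h u e \<in> face m h"
  and nxt_to_hole: "e \<in> root_face u \<Longrightarrow> nxt m (to_hole m h u (nxt u e)) = to_hole m h u e"
  and to_fill_to_hole: "e \<in> root_face u \<Longrightarrow> to_fill m h u (to_hole m h u e) = e"
  using hole.reverse_match_base hole.reverse_match_in hole.reverse_match_step hole.reverse_match_inverse
  unfolding to_fill_reverse_match to_hole_reverse_match face_def root_face_def by blast+

end

text \<open>Keeps the clauses of \<open>quadrangulation_with_holes\<close> on the position of the
  holes, without face degrees and without the quantification over \<open>nat\<close> fillings. It
  thus makes sense for any type of darts and is available for a ring before its gluings are known to
  be planar.\<close>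

definition proper_holes :: "'d hmap \<Rightarrow> bool" where
  "proper_holes m \<longleftrightarrow> planar_map m \<and> marks m \<subseteq> darts m \<and> inj_on (face m) (marks m) \<and>
     rootd m \<notin> hole_darts m \<and> (\<forall>d\<in>hole_darts m. opp m d \<notin> hole_darts m)"

lemma proper_holesD:
  assumes "proper_holes m"
  shows "planar_map m" "marks m \<subseteq> darts m" "inj_on (face m) (marks m)"
    and "rootd m \<notin> hole_darts m" "d \<in> hole_darts m \<Longrightarrow> opp m d \<notin> hole_darts m"
  using assms by (auto simp: proper_holes_def)

lemma QHmaps_proper_holes: "m \<in> QHmaps \<Longrightarrow> proper_holes m"
  by (auto simp: proper_holes_def QHmaps_def quadrangulation_with_holes_def)

lemma hole_darts_subset:
  assumes "proper_holes m"
  shows "hole_darts m \<subseteq> darts m"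
  using face_self(2)[OF proper_holesD(1)[OF assms]] proper_holesD(2)[OF assms]
  unfolding hole_darts_def by blast

lemma hole_of_eq:
  assumes "proper_holes m" "h \<in> marks m" "d \<in> face m h"
  shows "hole_of m d = h"
  unfolding hole_of_def
proof (rule the_equality)
  note ph = proper_holesD[OF assms(1)]
  fix h' assume "h' \<in> marks m \<and> d \<in> face m h'"
  then have "face m h' = face m h"
    using face_eq[OF ph(1)] assms ph(2) by (metis subsetD)
  then show "h' = h" using ph(3) \<open>h' \<in> marks m \<and> _\<close> assms(2) by (auto dest: inj_onD)
qed (use assms in simp)

lemma nxt_hole_darts_iff:
  assumes "proper_holes m" "d \<in> darts m"
  shows "nxt m d \<in> hole_darts m \<longleftrightarrow> d \<in> hole_darts m"
  using nxt_in_face_iff[OF proper_holesD(1)[OF assms(1)] _ assms(2)] proper_holesD(2)[OF assms(1)]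
  unfolding hole_darts_def by blast

lemma root_face_hole_darts:
  assumes "proper_holes m"
  shows "root_face m \<inter> hole_darts m = {}"
proof -
  note ph = proper_holesD[OF assms]
  have "rootd m \<in> hole_darts m" if "d \<in> root_face m" "d \<in> hole_darts m" for d
  proof -
    obtain h where h: "h \<in> marks m" "d \<in> face m h" using \<open>d \<in> hole_darts m\<close> by (auto simp: hole_darts_def)
    have "face m h = face m d" using face_eq[OF ph(1) _ h(2)] h(1) ph(2) by blast
    also have "\<dots> = root_face m"
      using face_eq[OF ph(1) planar_mapD(2)[OF ph(1)]] that(1) by (simp add: root_face_def)
    finally show ?thesis using root_face_subset(1)[OF ph(1)] h(1) by (auto simp: hole_darts_def)
  qed
  then show ?thesis using ph(4) by blast
qed

lemma disjoint_holes:
  assumes "proper_holes m" "h \<in> marks m" "h' \<in> marks m" "h \<noteq> h'"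
  shows "face m h \<inter> face m h' = {}"
  using hole_of_eq[OF assms(1)] assms(2-4) by blast

section \<open>Rings\<close>

text \<open>The last clause says that turning twice around a vertex comes back to the start: every
  vertex has degree two, so the common contour is simple. With \<open>opp c k = rootd c\<close>,
  gluing the ring into a hole leaves the marked edge in place.\<close>

definition ring_map :: "'d hmap \<Rightarrow> 'd \<Rightarrow> bool" where
  "ring_map c k \<longleftrightarrow> planar_map c \<and> marks c = {k} \<and> k \<in> darts c \<and> opp c k = rootd c \<and>
     darts c = root_face c \<union> face c k \<and> root_face c \<inter> face c k = {} \<and>
     opp c ` root_face c = face c k \<and> (\<forall>d\<in>darts c. nxt c (opp c (nxt c (opp c d))) = d)"

text \<open>Planarity is left out on purpose, since it is used in both directions:
  \<open>ring_mapI\<close> derives it from vertices of degree two, \<open>nxt_opp_involution\<close>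
  derives vertices of degree two from it.\<close>

locale two_faced =
  fixes c :: "'d hmap" and k :: 'd
  assumes fin: "finite (darts c)" and root: "rootd c \<in> darts c" and k: "k \<in> darts c"
    and opp: "d \<in> darts c \<Longrightarrow> opp c d \<in> darts c \<and> opp c d \<noteq> d \<and> opp c (opp c d) = d"
    and bij: "bij_betw (nxt c) (darts c) (darts c)"
    and darts: "darts c = root_face c \<union> face c k" and disj: "root_face c \<inter> face c k = {}"
    and opp_root: "opp c ` root_face c = face c k"
begin

lemma self: "d \<in> darts c \<Longrightarrow> d \<in> face c d"
  unfolding face_def using orbit_self_in[OF fin bij] .

lemma face_cases: "d \<in> root_face c \<Longrightarrow> face c d = root_face c" "d \<in> face c k \<Longrightarrow> face c d = face c k"
  using orbit_eq_if_in[OF self[OF root, unfolded face_def]] orbit_eq_if_in[OF self[OF k, unfolded face_def]]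
  unfolding face_def root_face_def by blast+

lemma opp_face: "d \<in> root_face c \<Longrightarrow> opp c d \<in> face c k" "d \<in> face c k \<Longrightarrow> opp c d \<in> root_face c"
proof -
  assume "d \<in> face c k"
  then obtain e where "e \<in> root_face c" "d = opp c e" unfolding opp_root[symmetric] by blast
  then show "opp c d \<in> root_face c" using opp[of e] darts by auto
qed (use opp_root in blast)

lemma card_faces: "card (faces c) = 2"
proof -
  have "faces c = {root_face c, face c k}"
  proof
    show "faces c \<subseteq> {root_face c, face c k}"
      unfolding faces_def darts using face_cases by blast
    show "{root_face c, face c k} \<subseteq> faces c"
      unfolding faces_def root_face_def using root k by blast
  qed
  moreover have "root_face c \<noteq> face c k" using disj self[OF k] by blast
  ultimately show ?thesis by simp
qed

text \<open>Each pair has a single element in the root face and is determined by it. With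
  \<open>s\<close> the opposite the pairs are edges, with \<open>s\<close> a turn around the end
  point they are vertices of degree two.\<close>

lemma card_pairs:
  assumes "\<And>d. d \<in> root_face c \<Longrightarrow> s d \<in> face c k"
  shows "card ((\<lambda>d. {d, s d}) ` root_face c) = card (root_face c)"
proof (rule card_image, rule inj_onI)
  fix d e assume de: "d \<in> root_face c" "e \<in> root_face c" and eq: "{d, s d} = {e, s e}"
  have "d \<in> {e, s e}" using eq by blast
  moreover have "d \<noteq> s e" using assms[OF de(2)] de(1) disj by blast
  ultimately show "d = e" by simp
qed

lemma card_edges: "card (edges c) = card (root_face c)"
proof -
  have orb: "orbit (opp c) d = {d, opp c d}" if "d \<in> darts c" for d
    using opp[OF that] by (intro orbit_involution) simp
  have "edges c = (\<lambda>d. {d, opp c d}) ` darts c"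
    unfolding edges_def using orb by (rule image_cong[OF refl])
  also have "\<dots> = (\<lambda>d. {d, opp c d}) ` root_face c"
  proof (intro equalityI subsetI)
    fix X assume "X \<in> (\<lambda>d. {d, opp c d}) ` darts c"
    then obtain d where d: "d \<in> darts c" "X = {d, opp c d}" by blast
    then have X: "X = {opp c d, opp c (opp c d)}" using opp[OF d(1)] by auto
    show "X \<in> (\<lambda>d. {d, opp c d}) ` root_face c"
    proof (cases "d \<in> root_face c")
      case True then show ?thesis using d(2) by blast
    next
      case False
      then have "opp c d \<in> root_face c" using d(1) darts opp_face(2) by blast
      then show ?thesis using X by blast
    qed
  qed (use darts in blast)
  finally show ?thesis using card_pairs[of "opp c"] opp_face(1) by simp
qed

lemma nxt_opp_face:
  "d \<in> root_face c \<Longrightarrow> nxt c (opp c d) \<in> face c k" "d \<in> face c k \<Longrightarrow> nxt c (opp c d) \<in> root_face c"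
  using opp_face by (auto simp: face_def root_face_def intro: orbit.step)

lemma self_vertex: "d \<in> darts c \<Longrightarrow> d \<in> orbit (nxt c \<circ> opp c) d"
proof (rule orbit_self_in[OF fin])
  have "bij_betw (opp c) (darts c) (darts c)"
    using opp by (intro bij_betw_byWitness[where f' = "opp c"]) auto
  then show "bij_betw (nxt c \<circ> opp c) (darts c) (darts c)" using bij by (rule bij_betw_trans)
qed

text \<open>A turn around a vertex switches between the two faces, so no vertex avoids the root
  face.\<close>

lemma vertices_eq: "vertices c = orbit (nxt c \<circ> opp c) ` root_face c"
proof (intro equalityI subsetI)
  fix X assume "X \<in> vertices c"
  then obtain d where d: "d \<in> darts c" "X = orbit (nxt c \<circ> opp c) d" unfolding vertices_def by blast
  show "X \<in> orbit (nxt c \<circ> opp c) ` root_face c"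
  proof (cases "d \<in> root_face c")
    case True then show ?thesis using d(2) by blast
  next
    case False
    then have "(nxt c \<circ> opp c) d \<in> root_face c" using d(1) darts nxt_opp_face(2) by auto
    moreover have "X = orbit (nxt c \<circ> opp c) ((nxt c \<circ> opp c) d)"
      using self_in_orbit_step[OF self_vertex[OF d(1)]] d(2) by blast
    ultimately show ?thesis by blast
  qed
qed (use darts in \<open>auto simp: vertices_def\<close>)

lemma card_vertices:
  assumes "\<And>d. d \<in> darts c \<Longrightarrow> nxt c (opp c (nxt c (opp c d))) = d"
  shows "card (vertices c) = card (root_face c)"
proof -
  have orb: "orbit (nxt c \<circ> opp c) d = {d, nxt c (opp c d)}" if "d \<in> root_face c" for d
    using orbit_involution[of "nxt c \<circ> opp c" d] assms[of d] that darts by auto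
  have "vertices c = (\<lambda>d. {d, nxt c (opp c d)}) ` root_face c"
    unfolding vertices_eq using orb by (rule image_cong[OF refl])
  then show ?thesis using card_pairs[of "\<lambda>d. nxt c (opp c d)"] nxt_opp_face(1) by simp
qed

lemma connected:
  assumes "d \<in> darts c"
  shows "(rootd c, d) \<in> {(a, b). a \<in> darts c \<and> (b = opp c a \<or> b = nxt c a)}\<^sup>*" (is "_ \<in> ?R\<^sup>*")
proof -
  have root: "(rootd c, e) \<in> ?R\<^sup>*" if "e \<in> root_face c" for e
    using that unfolding root_face_def face_def
  proof (induction rule: orbit.induct)
    case base
    then show ?case using root by (intro r_into_rtrancl) simp
  next
    case (step y)
    then have "y \<in> darts c" using darts by (simp add: root_face_def face_def)
    then have "(y, nxt c y) \<in> ?R" by simp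
    with step.IH show ?case by (rule rtrancl_into_rtrancl)
  qed
  show ?thesis
  proof (cases "d \<in> root_face c")
    case False
    then have d: "opp c d \<in> root_face c" using assms darts opp_face(2) by blast
    then have "(opp c d, d) \<in> ?R" using opp[OF assms] by simp
    with root[OF d] show ?thesis by (rule rtrancl_into_rtrancl)
  qed (rule root)
qed

text \<open>Euler's relation forces as many vertices as edges, hence two darts at each vertex.\<close>

lemma nxt_opp_involution:
  assumes "planar_map c" "d \<in> darts c"
  shows "nxt c (opp c (nxt c (opp c d))) = d"
proof -
  let ?s = "nxt c \<circ> opp c"
  have "card (orbit ?s ` root_face c) = card (root_face c)"
    using planar_mapD(8)[OF assms(1)] card_faces card_edges vertices_eq by simp
  moreover have "finite (root_face c)" using fin darts by simp
  ultimately have inj: "inj_on (orbit ?s) (root_face c)" by (intro eq_card_imp_inj_on)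
  \<comment> \<open>Two turns stay at the same vertex and come back to the root face, where each
    vertex is now known to have only one semi-edge.\<close>
  have root: "?s (?s e) = e" if e: "e \<in> root_face c" for e
  proof -
    have "?s (?s e) \<in> root_face c" using nxt_opp_face e by simp
    moreover have "orbit ?s (?s (?s e)) = orbit ?s e"
      using orbit_eq_if_in[OF self_vertex, of e "?s (?s e)"] e darts
      by (metis UnI1 orbit.base orbit.step)
    ultimately show ?thesis using inj e by (auto dest: inj_onD)
  qed
  show ?thesis
  proof (cases "d \<in> root_face c")
    case False
    \<comment> \<open>One turn leads into the root face, where the identity is known; being
      injective, the turn can be cancelled.\<close>
    then have "?s d \<in> root_face c" using assms(2) darts nxt_opp_face(2) by auto
    then have "?s (?s (?s d)) = ?s d" by (rule root)
    moreover have "?s (?s d) \<in> darts c"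
      using bij_nxt_opp[OF assms(1)] assms(2) by (meson bij_betwE)
    ultimately show ?thesis
      using inj_onD[OF bij_betw_imp_inj_on[OF bij_nxt_opp[OF assms(1)]]] assms(2) by auto
  qed (use root in simp)
qed

lemma ring_mapI:
  assumes "marks c = {k}" "opp c k = rootd c"
    and "\<And>d. d \<in> darts c \<Longrightarrow> nxt c (opp c (nxt c (opp c d))) = d"
  shows "ring_map c k"
proof -
  have "planar_map c" unfolding planar_map_def
    using fin root opp bij connected card_faces card_edges card_vertices[OF assms(3)] by simp
  then show ?thesis unfolding ring_map_def
    using assms k darts disj opp_root by blast
qed

end

lemma ring_map_two_faced:
  assumes "ring_map c k"
  shows "two_faced c k"
proof -
  have c: "planar_map c" using assms by (simp add: ring_map_def)
  show ?thesis
  proof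
    fix d assume "d \<in> darts c"
    then show "opp c d \<in> darts c \<and> opp c d \<noteq> d \<and> opp c (opp c d) = d"
      using planar_mapD(4-6)[OF c] by blast
  qed (use planar_mapD(1-3)[OF c] assms in \<open>unfold ring_map_def, blast+\<close>)
qed

context
  fixes c :: "'d hmap" and k :: 'd
  assumes ring: "ring_map c k"
begin

interpretation two_faced c k using ring by (rule ring_map_two_faced)

lemma ring_mapD:
  shows "planar_map c" "marks c = {k}" "k \<in> darts c" "opp c k = rootd c" "hole_darts c = face c k"
    and "darts c = root_face c \<union> face c k" "root_face c \<inter> face c k = {}"
    and "d \<in> darts c \<Longrightarrow> nxt c (opp c (nxt c (opp c d))) = d"
  using ring unfolding ring_map_def hole_darts_def by auto

lemma ring_opp:
  shows "d \<in> darts c \<Longrightarrow> opp c (opp c d) = d"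
    and "d \<in> root_face c \<Longrightarrow> opp c d \<in> face c k" "d \<in> face c k \<Longrightarrow> opp c d \<in> root_face c"
    and "d \<in> root_face c \<Longrightarrow> opp c d \<notin> root_face c"
  using opp opp_face disj by blast+

text \<open>The two contours of a ring run past each other in opposite senses: the opposite of the
  next semi-edge precedes the opposite of the present one. This reversal cancels the one made by
  \<open>to_fill\<close> and \<open>to_hole\<close>.\<close>

lemma ring_nxt_opp_nxt:
  assumes "d \<in> darts c"
  shows "nxt c (opp c (nxt c d)) = opp c d"
  using ring_mapD(8)[of "opp c d"] ring_opp(1) opp assms by simp

lemma card_ring_hole: "card (face c k) = perimeter c"
proof -
  have "inj_on (opp c) (root_face c)" using ring_opp(1) darts by (metis inj_on_inverseI UnI1)
  then show ?thesis unfolding perimeter_def using card_image opp_root by metis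
qed

lemma ring_proper_holes: "proper_holes c"
  unfolding proper_holes_def
proof (intro conjI ballI)
  show "rootd c \<notin> hole_darts c"
    using root_face_subset(1)[OF ring_mapD(1)] ring_mapD(5) disj by blast
  fix d assume "d \<in> hole_darts c"
  then show "opp c d \<notin> hole_darts c" using ring_opp(3) disj unfolding ring_mapD(5) by blast
qed (simp_all add: ring_mapD(1-3))

end

text \<open>
  Filling every hole with a ring replaces each semi-edge of a hole by the semi-edge of the ring
  opposite to its match, which keeps the map up to isomorphism.
\<close>

lemma glue_rings_iso:
  assumes m: "proper_holes m"
    and ring: "\<And>h. h \<in> marks m \<Longrightarrow> ring_map (u h) (k h)"
    and perim: "\<And>h. h \<in> marks m \<Longrightarrow> perimeter (u h) = card (face m h)"
  shows "map_iso m (glue m u)"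
proof -
  note ph = proper_holesD[OF m]
  define g where "g = (\<lambda>d. if d \<in> hole_darts m
    then Inr (hole_of m d, opp (u (hole_of m d)) (to_fill m (hole_of m d) (u (hole_of m d)) d)) else Inl d)"
  define g' where "g' = (\<lambda>x. case x of Inl d \<Rightarrow> d | Inr (h, e) \<Rightarrow> to_hole m h (u h) (opp (u h) e))"
  have hf: "hole_filling m h (u h)" if "h \<in> marks m" for h
    using that ph(1,2) ring[OF that] perim[OF that] by unfold_locales (auto simp: ring_map_def)
  have ghole: "g d = Inr (h, opp (u h) (to_fill m h (u h) d))" if "h \<in> marks m" "d \<in> face m h" for h d
    using hole_of_eq[OF m that] that by (auto simp: g_def hole_darts_def)
  have gout: "g d = Inl d" if "d \<notin> hole_darts m" for d using that by (simp add: g_def)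
  have fill_darts: "to_fill m h (u h) d \<in> root_face (u h)" "to_fill m h (u h) d \<in> darts (u h)"
    if "h \<in> marks m" for h d
    using hole_filling.to_fill_in[OF hf[OF that]] root_face_subset(2) ring[OF that]
    by (auto simp: ring_map_def)
  have hole_cases: "\<exists>h\<in>marks m. d \<in> face m h" if "d \<in> hole_darts m" for d
    using that by (auto simp: hole_darts_def)
  have face_hole: "d \<in> hole_darts m" if "h \<in> marks m" "d \<in> face m h" for h d
    using that by (auto simp: hole_darts_def)
  have outer: "darts (u h) - root_face (u h) = face (u h) (k h)" if "h \<in> marks m" for h
    using ring_mapD(6,7)[OF ring[OF that]] by blast
  have "bij_betw g (darts m) (darts (glue m u))"
  proof (rule bij_betw_byWitness[where f' = g'])
    show "\<forall>d\<in>darts m. g' (g d) = d"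
    proof
      fix d assume "d \<in> darts m"
      show "g' (g d) = d"
      proof (cases "d \<in> hole_darts m")
        case True
        then obtain h where h: "h \<in> marks m" "d \<in> face m h" using hole_cases by blast
        then show ?thesis
          using ring_opp(1)[OF ring[OF h(1)]] fill_darts[OF h(1)]
            hole_filling.to_hole_to_fill[OF hf[OF h(1)] h(2)]
          by (simp add: ghole g'_def)
      qed (simp add: gout g'_def)
    qed
    show "\<forall>x\<in>darts (glue m u). g (g' x) = x"
    proof
      fix x assume x: "x \<in> darts (glue m u)"
      show "g (g' x) = x"
      proof (cases x)
        case (Inl d)
        then show ?thesis using x by (auto simp: glue_def g'_def gout)
      next
        case (Inr p)
        then obtain h e where he: "x = Inr (h, e)" "h \<in> marks m" "e \<in> darts (u h)" "e \<notin> root_face (u h)"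
          using x by (auto simp: glue_def)
        then have "opp (u h) e \<in> root_face (u h)"
          using ring_opp(3)[OF ring[OF he(2)]] outer[OF he(2)] by blast
        then show ?thesis
          using he ghole[OF he(2) hole_filling.to_hole_in[OF hf[OF he(2)]]]
            hole_filling.to_fill_to_hole[OF hf[OF he(2)]] ring_opp(1)[OF ring[OF he(2)]]
          by (simp add: g'_def)
      qed
    qed
    show "g ` darts m \<subseteq> darts (glue m u)"
    proof (rule image_subsetI)
      fix d assume d: "d \<in> darts m"
      show "g d \<in> darts (glue m u)"
      proof (cases "d \<in> hole_darts m")
        case True
        then obtain h where h: "h \<in> marks m" "d \<in> face m h" using hole_cases by blast
        have "opp (u h) (to_fill m h (u h) d) \<in> darts (u h) - root_face (u h)"
          using ring_opp(2)[OF ring[OF h(1)]] fill_darts(1)[OF h(1)] outer[OF h(1)] by blast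
        then show ?thesis using h ghole[OF h] by (simp add: glue_def)
      qed (use d in \<open>simp add: gout glue_def\<close>)
    qed
    show "g' ` darts (glue m u) \<subseteq> darts m"
    proof (rule image_subsetI)
      fix x assume x: "x \<in> darts (glue m u)"
      show "g' x \<in> darts m"
      proof (cases x)
        case (Inl d)
        then show ?thesis using x by (auto simp: glue_def g'_def)
      next
        case (Inr p)
        then obtain h e where he: "x = Inr (h, e)" "h \<in> marks m"
          using x by (auto simp: glue_def)
        then have "to_hole m h (u h) (opp (u h) e) \<in> darts m"
          using hole_filling.to_hole_in[OF hf[OF he(2)]] face_hole hole_darts_subset[OF m] by blast
        then show ?thesis using he by (simp add: g'_def)
      qed
    qed
  qed
  \<comment> \<open>No edge has holes on both sides, so at most one of \<open>d\<close> and
    \<open>opp m d\<close> is moved into a ring, and a single passage through that ring closes the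
    edge.\<close>
  moreover have "g (opp m d) = opp (glue m u) (g d)" if d: "d \<in> darts m" for d
  proof (cases "d \<in> hole_darts m")
    case True
    then obtain h where h: "h \<in> marks m" "d \<in> face m h" using hole_cases by blast
    then show ?thesis
      using ring_opp(1)[OF ring[OF h(1)]] fill_darts[OF h(1)] gout[OF ph(5)[OF True]]
        hole_filling.to_hole_to_fill[OF hf[OF h(1)] h(2)]
      by (simp add: ghole glue_def leave_fill_def)
  next
    case out: False
    show ?thesis
    proof (cases "opp m d \<in> hole_darts m")
      case True
      then obtain h where h: "h \<in> marks m" "opp m d \<in> face m h" using hole_cases by blast
      have "opp (u h) (to_fill m h (u h) (opp m d)) \<notin> root_face (u h)"
        using ring_opp(4)[OF ring[OF h(1)]] fill_darts(1)[OF h(1)] by blast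
      then show ?thesis
        using True hole_of_eq[OF m h] by (simp add: gout[OF out] ghole[OF h] glue_def leave_fill_def Let_def)
    qed (simp add: gout out glue_def)
  qed
  moreover have "g (nxt m d) = nxt (glue m u) (g d)" if d: "d \<in> darts m" for d
  proof (cases "d \<in> hole_darts m")
    case True
    then obtain h where h: "h \<in> marks m" "d \<in> face m h" using hole_cases by blast
    then have nd: "nxt m d \<in> face m h" unfolding face_def by (simp add: orbit.step)
    \<comment> \<open>Matching reverses the contour of the hole and crossing the ring reverses it
      again.\<close>
    have "nxt (u h) (opp (u h) (to_fill m h (u h) d)) = opp (u h) (to_fill m h (u h) (nxt m d))"
      using ring_nxt_opp_nxt[OF ring[OF h(1)] fill_darts(2)[OF h(1)], of "nxt m d"]
        hole_filling.nxt_to_fill[OF hf[OF h(1)] h(2)] by simp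
    then show ?thesis using ghole[OF h] ghole[OF h(1) nd] by (simp add: glue_def)
  next
    case False
    then have "nxt m d \<notin> hole_darts m" using nxt_hole_darts_iff[OF m d] by simp
    then show ?thesis using False by (simp add: gout glue_def)
  qed
  moreover have "g (rootd m) = rootd (glue m u)" using ph(4) by (simp add: gout glue_def)
  moreover have "g ` marks m = marks (glue m u)"
  proof -
    have gh: "g h = Inr (h, k h)" and km: "marks (u h) = {k h}" if h: "h \<in> marks m" for h
    proof -
      have "h \<in> face m h" using face_self(1)[OF ph(1)] ph(2) h by blast
      moreover have "opp (u h) (rootd (u h)) = k h"
        using ring_mapD(3,4)[OF ring[OF h]] ring_opp(1)[OF ring[OF h]] by metis
      ultimately show "g h = Inr (h, k h)"
        using ghole[OF h] hole_filling.to_fill_mark[OF hf[OF h]] by simp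
      show "marks (u h) = {k h}" using ring_mapD(2)[OF ring[OF h]] .
    qed
    have "g ` marks m = (\<lambda>h. Inr (h, k h)) ` marks m" using gh by (rule image_cong[OF refl])
    also have "\<dots> = Inr ` (SIGMA h:marks m. {k h})" by auto
    also have "(SIGMA h:marks m. {k h}) = (SIGMA h:marks m. marks (u h))"
      using km by (intro Sigma_cong) simp_all
    finally show ?thesis by (simp add: glue_def)
  qed
  ultimately show ?thesis unfolding map_iso_def by blast
qed

lemma planar_map_marks: "planar_map (m\<lparr>marks := X\<rparr>) \<longleftrightarrow> planar_map m"
  by (simp add: planar_map_def vertices_def faces_def edges_def face_def)

lemma glue_into_ring_iso:
  fixes c :: "'a hmap" and u :: "'a \<Rightarrow> 'b hmap"
  assumes ring: "ring_map c k" and v: "planar_map (u k)" and perim: "perimeter (u k) = perimeter c"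
  shows "map_iso (u k\<lparr>marks := {}\<rparr>) (glue c u\<lparr>marks := {}\<rparr>)"
proof -
  define v where "v = u k"
  note rd = ring_mapD[OF ring] and ro = ring_opp[OF ring]
  note ph = ring_proper_holes[OF ring]
  interpret hole_filling c k v
    using rd v perim card_ring_hole[OF ring] by unfold_locales (simp_all add: v_def)
  \<comment> \<open>With \<open>leave_fill\<close> itself as the bijection, an edge having the root
    face of \<open>v\<close> on both sides needs no separate treatment.\<close>
  define g where "g = leave_fill c u k"
  have g: "g e = (if e \<in> root_face v then Inl (opp c (to_hole c k v e)) else Inr (k, e))" for e
    by (simp add: g_def leave_fill_def v_def)
  define g' where "g' = (\<lambda>x :: 'a + 'a \<times> 'b. case x of Inl d \<Rightarrow> to_fill c k v (opp c d) | Inr (h, e) \<Rightarrow> e)"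
  have darts_glue: "darts (glue c u) = Inl ` root_face c \<union> Inr ` ({k} \<times> (darts v - root_face v))"
    using rd(2,5-7) by (auto simp: glue_def v_def)
  have hole_darts: "e \<in> darts c" if "e \<in> face c k" for e using that rd(6) by blast
  have opp_glue: "opp (glue c u) (Inl d) = g (opp v (to_fill c k v (opp c d)))" if "d \<in> root_face c" for d
  proof -
    have od: "opp c d \<in> face c k" using ro(2) that .
    then have "hole_of c (opp c d) = k" using hole_of_eq[OF ph] rd(2) by blast
    then show ?thesis using od rd(5) by (simp add: glue_def Let_def g_def v_def)
  qed
  have "bij_betw g (darts v) (darts (glue c u))"
  proof (rule bij_betw_byWitness[where f' = g'])
    show "\<forall>e\<in>darts v. g' (g e) = e"
      using to_hole_in to_fill_to_hole ro(1) hole_darts by (simp add: g g'_def)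
    show "\<forall>x\<in>darts (glue c u). g (g' x) = x"
    proof
      fix x assume "x \<in> darts (glue c u)"
      then consider d where "x = Inl d" "d \<in> root_face c"
        | e where "x = Inr (k, e)" "e \<notin> root_face v" unfolding darts_glue by blast
      then show "g (g' x) = x"
      proof cases
        case 1
        then have "d \<in> darts c" using rd(6) by blast
        then show ?thesis using 1 ro(1) to_hole_to_fill[OF ro(2)] to_fill_in by (simp add: g g'_def)
      qed (simp add: g g'_def)
    qed
    show "g ` darts v \<subseteq> darts (glue c u)"
      unfolding darts_glue using ro(3)[OF to_hole_in] by (auto simp: g)
    show "g' ` darts (glue c u) \<subseteq> darts v"
      unfolding darts_glue using to_fill_in root_face_subset(2)[OF u] by (auto simp: g'_def)
  qed
  moreover have "g (opp v e) = opp (glue c u) (g e)" if e: "e \<in> darts v" for e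
  proof (cases "e \<in> root_face v")
    case True
    have "opp (glue c u) (g e) = g (opp v (to_fill c k v (to_hole c k v e)))"
      using True opp_glue[OF ro(3)[OF to_hole_in]] ro(1)[OF hole_darts[OF to_hole_in]] by (simp add: g)
    then show ?thesis using to_fill_to_hole[OF True] by simp
  next
    case False
    then show ?thesis by (simp add: g[of e]) (simp add: glue_def g_def v_def)
  qed
  moreover have "g (nxt v e) = nxt (glue c u) (g e)" if e: "e \<in> darts v" for e
  proof (cases "e \<in> root_face v")
    case True
    then have ne: "nxt v e \<in> root_face v" by (simp add: root_face_def face_def orbit.step)
    have "nxt c (opp c (to_hole c k v e)) = opp c (to_hole c k v (nxt v e))"
      using nxt_to_hole[OF True] ring_nxt_opp_nxt[OF ring hole_darts[OF to_hole_in]] by metis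
    then show ?thesis using True ne by (simp add: g glue_def)
  next
    case False
    then have "nxt v e \<notin> root_face v"
      using nxt_in_face_iff[OF u planar_mapD(2)[OF u] e] by (simp add: root_face_def)
    then show ?thesis using False by (simp add: g glue_def v_def)
  qed
  moreover have "g (rootd v) = rootd (glue c u)"
    using to_hole_root rd(4) root_face_subset(1)[OF u] by (simp add: g glue_def)
  ultimately show ?thesis unfolding map_iso_def v_def[symmetric]
    by (intro exI[of _ g]) simp
qed

text \<open>Apart from the root face and the hole there is no face whose degree could be wrong, and
  filling the hole returns the filling, which is planar by assumption.\<close>

lemma ring_quadrangulation_with_holes:
  fixes c :: "nat hmap"
  assumes ring: "ring_map c k"
  shows "quadrangulation_with_holes c"
  unfolding quadrangulation_with_holes_def
proof (intro conjI allI impI)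
  note ph = proper_holesD[OF ring_proper_holes[OF ring]]
  show "planar_map c" "marks c \<subseteq> darts c" "inj_on (face c) (marks c)" "rootd c \<notin> hole_darts c"
    "\<forall>d\<in>hole_darts c. opp c d \<notin> hole_darts c"
    using ph by blast+
  show "\<forall>d\<in>darts c - root_face c - hole_darts c. card (face c d) = 4"
    using ring_mapD(5,6)[OF ring] by blast
  fix u :: "nat \<Rightarrow> nat hmap"
  assume u: "\<forall>h\<in>marks c. planar_map (u h) \<and> perimeter (u h) = card (face c h)"
  then have "planar_map (u k)" "perimeter (u k) = perimeter c"
    using ring_mapD(2)[OF ring] card_ring_hole[OF ring] by simp_all
  then have "planar_map (glue c u\<lparr>marks := {}\<rparr>)"
    using planar_map_iso[OF glue_into_ring_iso[OF ring]] planar_map_marks by blast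
  then show "planar_map (glue c u)" by (simp only: planar_map_marks)
qed

lemma ring_map_iso:
  assumes ring: "ring_map a k" and iso: "map_iso a b"
  shows "\<exists>k'. ring_map b k'" "perimeter b = perimeter a"
proof -
  obtain f where f: "bij_betw f (darts a) (darts b)"
    "\<And>d. d \<in> darts a \<Longrightarrow> f (opp a d) = opp b (f d)"
    "\<And>d. d \<in> darts a \<Longrightarrow> f (nxt a d) = nxt b (f d)"
    "f (rootd a) = rootd b" "f ` marks a = marks b"
    using iso unfolding map_iso_def by blast
  note rd = ring_mapD[OF ring]
  note pm = planar_mapD[OF rd(1)]
  have face: "face b (f d) = f ` face a d" if "d \<in> darts a" for d
    using iso_face[of a f b d] rd(1) f(3) that by blast
  have inj: "inj_on f (darts a)" and D: "darts b = f ` darts a"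
    using f(1) by (auto simp: bij_betw_def)
  have root: "root_face b = f ` root_face a"
    unfolding root_face_def using face[OF pm(2)] f(4) by simp
  have hole: "face b (f k) = f ` face a k"
    using face[OF rd(3)] .
  show "perimeter b = perimeter a"
    unfolding perimeter_def root using card_image inj_on_subset[OF inj] root_face_subset(2)[OF rd(1)] by blast
  have "planar_map b" using planar_map_iso[OF iso rd(1)] .
  moreover have "marks b = {f k}" using f(5) rd(2) by auto
  moreover have "f k \<in> darts b" using D rd(3) by blast
  moreover have "opp b (f k) = rootd b" using f(2)[OF rd(3)] rd(4) f(4) by simp
  moreover have "darts b = root_face b \<union> face b (f k)"
    unfolding root hole D using rd(6) by (simp add: image_Un)
  moreover have "root_face b \<inter> face b (f k) = {}"
    unfolding root hole using inj_on_image_Int[OF inj, of "root_face a" "face a k"] rd(6,7) by auto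
  moreover have "opp b ` root_face b = face b (f k)"
  proof -
    have "opp b ` root_face b = (\<lambda>d. f (opp a d)) ` root_face a"
      unfolding root image_image using f(2) rd(6) by (intro image_cong) auto
    also have "\<dots> = f ` opp a ` root_face a" by (simp add: image_image)
    also have "opp a ` root_face a = face a k" using ring by (simp add: ring_map_def)
    finally show ?thesis using hole by simp
  qed
  moreover have "nxt b (opp b (nxt b (opp b e))) = e" if "e \<in> darts b" for e
  proof -
    from that obtain d where d: "d \<in> darts a" "e = f d" unfolding D by blast
    have "nxt b (opp b (nxt b (opp b (f d)))) = f (nxt a (opp a (nxt a (opp a d))))"
      using f(2,3) pm(4,7) d(1) by simp
    then show ?thesis using rd(8)[OF d(1)] d(2) by simp
  qed
  ultimately show "\<exists>k'. ring_map b k'" unfolding ring_map_def by blast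
qed

section \<open>A concrete ring of every positive perimeter\<close>

text \<open>The Boolean tells the side, \<open>True\<close> being the root face. Opposite sides are
  numbered in opposite senses, so \<open>opp\<close> takes \<open>i\<close> to its negative modulo
  \<open>p\<close>, and the two semi-edges numbered \<open>0\<close> form the root edge.\<close>

definition cycle :: "nat \<Rightarrow> (bool \<times> nat) hmap" where
  "cycle p = \<lparr>darts = UNIV \<times> {..<p}, opp = (\<lambda>(b, i). (\<not> b, (p - i) mod p)),
     nxt = (\<lambda>(b, i). (b, Suc i mod p)), rootd = (True, 0), marks = {(False, 0)}\<rparr>"

lemma face_cycle:
  assumes "0 < p"
  shows "face (cycle p) (b, 0) = {b} \<times> {..<p}"
proof -
  have pow: "(nxt (cycle p) ^^ n) (b, 0) = (b, n mod p)" for n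
    by (induct n) (simp_all add: cycle_def mod_Suc_eq)
  \<comment> \<open>An orbit consists of the iterates with positive exponent, so
    \<open>i + p\<close> steps are taken to cover \<open>i = 0\<close> as well.\<close>
  have "(b, i) \<in> face (cycle p) (b, 0)" if "i < p" for i
    using pow[of "i + p"] that assms unfolding face_def orbit_altdef by (auto intro!: exI[of _ "i + p"])
  moreover have "x \<in> {b} \<times> {..<p}" if "x \<in> face (cycle p) (b, 0)" for x
    using that assms unfolding face_def orbit_altdef by (auto simp: pow)
  ultimately show ?thesis by auto
qed

lemma cycle_ring:
  assumes p: "0 < p"
  shows "ring_map (cycle p) (False, 0)" "perimeter (cycle p) = p"
proof -
  have root: "root_face (cycle p) = {True} \<times> {..<p}"
    using face_cycle[OF p] by (simp add: root_face_def) (simp add: cycle_def face_cycle[OF p])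
  show "perimeter (cycle p) = p" unfolding perimeter_def root by (simp add: card_cartesian_product)
  have opp2: "(p - (p - i) mod p) mod p = i" if "i < p" for i
    using that by (cases "i = 0") simp_all
  have pred: "(Suc i mod p + p - Suc 0) mod p = i" if "i < p" for i
    using that by (cases "Suc i = p") simp_all
  have bij: "bij_betw (nxt (cycle p)) (darts (cycle p)) (darts (cycle p))"
  proof (rule bij_betw_byWitness[where f' = "\<lambda>(b, i). (b, (i + (p - 1)) mod p)"])
    show "\<forall>a\<in>darts (cycle p). (case nxt (cycle p) a of (b, i) \<Rightarrow> (b, (i + (p - 1)) mod p)) = a"
      "\<forall>a\<in>darts (cycle p). nxt (cycle p) (case a of (b, i) \<Rightarrow> (b, (i + (p - 1)) mod p)) = a"
      using p pred by (auto simp: cycle_def mod_simps)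
  qed (use p in \<open>auto simp: cycle_def\<close>)
  have "two_faced (cycle p) (False, 0)"
  proof
    show "darts (cycle p) = root_face (cycle p) \<union> face (cycle p) (False, 0)"
      "root_face (cycle p) \<inter> face (cycle p) (False, 0) = {}"
      unfolding root face_cycle[OF p] by (auto simp: cycle_def)
    show "opp (cycle p) ` root_face (cycle p) = face (cycle p) (False, 0)"
      unfolding root face_cycle[OF p]
    proof (intro equalityI subsetI)
      fix x assume "x \<in> {False} \<times> {..<p}"
      then obtain i where "i < p" "x = (False, i)" by blast
      then have "x = opp (cycle p) (True, (p - i) mod p)" using opp2 by (simp add: cycle_def)
      then show "x \<in> opp (cycle p) ` ({True} \<times> {..<p})" using p by auto
    qed (use p in \<open>auto simp: cycle_def\<close>)
  qed (use p bij opp2 in \<open>auto simp: root face_cycle cycle_def\<close>)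
  then interpret two_faced "cycle p" "(False, 0)" .
  show "ring_map (cycle p) (False, 0)"
  proof (rule ring_mapI)
    fix d assume "d \<in> darts (cycle p)"
    then obtain b i where d: "d = (b, i)" "i < p" by (auto simp: cycle_def)
    have "Suc ((p - Suc ((p - i) mod p) mod p) mod p) mod p = i"
    proof -
      \<comment> \<open>The residue of \<open>p - i\<close> wraps around at \<open>i = 0\<close> and
        its successor at \<open>i = 1\<close>; for \<open>p = 1\<close> every residue is
        \<open>0\<close>.\<close>
      consider "p = 1" | "i = 0" "1 < p" | "i = 1" "1 < p" | "1 < i" using d(2) by linarith
      then show ?thesis
      proof cases
        case 4
        then have "Suc ((p - i) mod p) mod p = Suc p - i" using d(2) by simp
        then show ?thesis using 4 d(2) by simp
      qed (use d in simp_all)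
    qed
    then show "nxt (cycle p) (opp (cycle p) (nxt (cycle p) (opp (cycle p) d))) = d"
      by (simp add: d cycle_def)
  qed (use p in \<open>simp_all add: cycle_def\<close>)
qed

lemma ring_in_QHmaps:
  assumes "0 < p"
  obtains c k where "c \<in> QHmaps" "ring_map c k" "perimeter c = p" "keeps_mark c"
proof -
  let ?c = "canon (cycle p)"
  note ring = cycle_ring[OF assms]
  note rd = ring_mapD[OF ring(1)]
  have iso: "map_iso (cycle p) ?c" using map_iso_canon[OF rd(1)] rd(2,3) by simp
  obtain k where k: "ring_map ?c k" using ring_map_iso(1)[OF ring(1) iso] by blast
  have "canon ?c = ?c" using canon_cong[OF iso rd(1)] rd(2,3) by simp
  then have "?c \<in> QHmaps" unfolding QHmaps_def using ring_quadrangulation_with_holes[OF k] by simp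
  moreover have "keeps_mark ?c" unfolding keeps_mark_def using ring_mapD(2,4)[OF k] by simp
  moreover have "perimeter ?c = p" using ring_map_iso(2)[OF ring(1) iso] ring(2) by simp
  ultimately show ?thesis using that k by blast
qed

section \<open>Reflexivity of inclusion\<close>

lemma submap_refl:
  assumes "x \<in> QH"
  shows "x \<preceq> x"
proof (cases x)
  case (Map m)
  then have m: "m \<in> QHmaps" using assms by (auto simp: QH_def)
  note ph = proper_holesD[OF QHmaps_proper_holes[OF m]]
  have "\<exists>c k. c \<in> QHmaps \<and> ring_map c k \<and> perimeter c = card (face m h) \<and> keeps_mark c"
    if h: "h \<in> marks m" for h
  proof -
    have "0 < card (face m h)"
      using face_self[OF ph(1)] h ph(2) by (metis card_gt_0_iff empty_iff subsetD)
    then show ?thesis by (metis ring_in_QHmaps)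
  qed
  then obtain c k where c: "\<And>h. h \<in> marks m \<Longrightarrow>
      c h \<in> QHmaps \<and> ring_map (c h) (k h) \<and> perimeter (c h) = card (face m h) \<and> keeps_mark (c h)"
    by metis
  define u where "u = (\<lambda>h. if h \<in> marks m then c h else undefined)"
  have "map_iso m (glue m u)"
    using c by (intro glue_rings_iso[OF QHmaps_proper_holes[OF m], where k = k]) (simp_all add: u_def)
  then have "canon (glue m u) = m" using canon_cong[OF _ ph(1,2)] QHmapsD(4)[OF m] by metis
  then have "filling x u m" using c Map by (simp add: filling_def u_def)
  then show ?thesis using Map by auto
qed simp

section \<open>Counting semi-edges and holes: antisymmetry of inclusion\<close>

text \<open>These semi-edges survive every gluing, as the \<open>Inl\<close> part of
  \<open>glue\<close>, so their number is monotone under inclusion.\<close>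

definition full_darts :: "'d hmap \<Rightarrow> 'd set" where
  "full_darts m = darts m - hole_darts m"

text \<open>Lets the counts be computed on \<open>glue m u\<close> instead of its opaque canonical
  representative.\<close>

lemma iso_counts:
  assumes iso: "map_iso a b" and a: "planar_map a" "marks a \<subseteq> darts a"
  shows "card (full_darts b) = card (full_darts a)"
    and "card (hole_darts b) = card (hole_darts a)"
    and "card (marks b) = card (marks a)"
proof -
  obtain f where f: "bij_betw f (darts a) (darts b)"
    "\<And>d. d \<in> darts a \<Longrightarrow> f (nxt a d) = nxt b (f d)" "f ` marks a = marks b"
    using iso unfolding map_iso_def by blast
  have inj: "inj_on f (darts a)" and D: "darts b = f ` darts a"
    using f(1) by (auto simp: bij_betw_def)
  have face: "face b (f d) = f ` face a d" if "d \<in> darts a" for d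
    using iso_face[of a f b d] a(1) f(2) that by blast
  have "hole_darts b = (\<Union>h\<in>marks a. face b (f h))" unfolding hole_darts_def f(3)[symmetric] by blast
  also have "\<dots> = (\<Union>h\<in>marks a. f ` face a h)" using face a(2) by (intro SUP_cong) auto
  finally have hole: "hole_darts b = f ` hole_darts a" unfolding hole_darts_def by blast
  have sub: "hole_darts a \<subseteq> darts a" unfolding hole_darts_def using face_self(2)[OF a(1)] a(2) by blast
  then have full: "full_darts b = f ` full_darts a"
    unfolding full_darts_def hole D using inj_on_image_set_diff[OF inj, of "darts a" "hole_darts a"] by blast
  have card: "card (f ` X) = card X" if "X \<subseteq> darts a" for X
    using card_image inj_on_subset[OF inj that] by blast
  show "card (full_darts b) = card (full_darts a)" unfolding full by (rule card) (auto simp: full_darts_def)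
  show "card (hole_darts b) = card (hole_darts a)" unfolding hole by (rule card[OF sub])
  show "card (marks b) = card (marks a)" unfolding f(3)[symmetric] by (rule card[OF a(2)])
qed

locale hole_fillings =
  fixes m :: "nat hmap" and u :: "nat \<Rightarrow> nat hmap"
  assumes m: "m \<in> QHmaps" and u: "h \<in> marks m \<Longrightarrow> u h \<in> QHmaps"
    and perim: "h \<in> marks m \<Longrightarrow> perimeter (u h) = card (face m h)"
    and keeps: "h \<in> marks m \<Longrightarrow> keeps_mark (u h)"
begin

lemmas ph = proper_holesD[OF QHmaps_proper_holes[OF m]]
lemmas phu = proper_holesD[OF QHmaps_proper_holes[OF u]]

text \<open>What the filling of \<open>h\<close> adds to \<open>full_darts\<close>: its root face is
  consumed by the gluing, and its holes are counted apart.\<close>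

definition inner_darts :: "nat \<Rightarrow> nat set" where
  "inner_darts h = darts (u h) - root_face (u h) - hole_darts (u h)"

lemma finite_marks: "finite (marks m)"
  using ph(1,2) planar_mapD(1) finite_subset by blast

lemma finite_fill:
  assumes "h \<in> marks m"
  shows "finite (darts (u h))" "finite (root_face (u h))" "finite (hole_darts (u h))" "finite (marks (u h))"
proof -
  show fin: "finite (darts (u h))" using phu(1)[OF assms] by (rule planar_mapD(1))
  show "finite (root_face (u h))" using phu(1)[OF assms] by (rule root_face_subset(3))
  show "finite (hole_darts (u h))"
    using hole_darts_subset[OF QHmaps_proper_holes[OF u[OF assms]]] fin by (rule finite_subset)
  show "finite (marks (u h))" using phu(2)[OF assms] fin by (rule finite_subset)
qed

lemma planar_glue: "planar_map (glue m u)"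
  using QHmapsD(1)[OF m] phu(1) perim unfolding quadrangulation_with_holes_def by blast

text \<open>On a filling, \<open>nxt\<close> of the glued map acts as in the filling alone, so the
  holes of the result are copies of those of the fillings.\<close>

lemma hole_darts_glue: "hole_darts (glue m u) = Inr ` (SIGMA h:marks m. hole_darts (u h))"
proof -
  have "face (glue m u) (Inr (h, e)) = (\<lambda>e. Inr (h, e)) ` face (u h) e" for h e
    unfolding face_def by (rule orbit_image_commute) (simp add: glue_def)
  then have face: "face (glue m u) (Inr p) = Inr ` ({fst p} \<times> face (u (fst p)) (snd p))" for p
    by (cases p) auto
  have mk: "marks (glue m u) = Inr ` (SIGMA h:marks m. marks (u h))" by (simp add: glue_def)
  have "hole_darts (glue m u) =
      Inr ` (\<Union>p\<in>(SIGMA h:marks m. marks (u h)). {fst p} \<times> face (u (fst p)) (snd p))"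
    unfolding hole_darts_def mk by (simp add: face image_UN)
  also have "(\<Union>p\<in>(SIGMA h:marks m. marks (u h)). {fst p} \<times> face (u (fst p)) (snd p)) =
      (SIGMA h:marks m. hole_darts (u h))"
    unfolding hole_darts_def by force
  finally show ?thesis .
qed

lemma marks_subset_hole_darts:
  assumes "h \<in> marks m"
  shows "marks (u h) \<subseteq> hole_darts (u h)"
  using face_self(1)[OF phu(1)[OF assms]] phu(2)[OF assms] unfolding hole_darts_def by blast

lemma marks_glue: "marks (glue m u) \<subseteq> darts (glue m u)"
proof -
  have "marks (u h) \<subseteq> darts (u h) - root_face (u h)" if "h \<in> marks m" for h
    using marks_subset_hole_darts[OF that] phu(2)[OF that]
      root_face_hole_darts[OF QHmaps_proper_holes[OF u[OF that]]] by blast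
  then show ?thesis by (auto simp: glue_def)
qed

lemma full_darts_glue:
  "full_darts (glue m u) = Inl ` full_darts m \<union> Inr ` (SIGMA h:marks m. inner_darts h)"
  unfolding full_darts_def hole_darts_glue inner_darts_def by (auto simp: glue_def)

lemma canon_glue_counts:
  shows "card (full_darts (canon (glue m u))) = card (full_darts m) + (\<Sum>h\<in>marks m. card (inner_darts h))"
    and "card (hole_darts (canon (glue m u))) = (\<Sum>h\<in>marks m. card (hole_darts (u h)))"
    and "card (marks (canon (glue m u))) = (\<Sum>h\<in>marks m. card (marks (u h)))"
proof -
  note iso = iso_counts[OF map_iso_canon[OF planar_glue marks_glue] planar_glue marks_glue]
  have inner: "finite (inner_darts h)" if "h \<in> marks m" for h
    using finite_fill(1)[OF that] by (simp add: inner_darts_def)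
  have "finite (full_darts m)" using ph(1) planar_mapD(1) by (auto simp: full_darts_def)
  then have "card (full_darts (glue m u)) =
      card (Inl ` full_darts m :: (nat + nat \<times> nat) set) +
      card (Inr ` (SIGMA h:marks m. inner_darts h) :: (nat + nat \<times> nat) set)"
    unfolding full_darts_glue using finite_marks inner
    by (intro card_Un_disjoint) (auto intro!: finite_SigmaI)
  also have "\<dots> = card (full_darts m) + (\<Sum>h\<in>marks m. card (inner_darts h))"
    using finite_marks inner by (simp add: card_image card_SigmaI)
  finally show "card (full_darts (canon (glue m u))) =
      card (full_darts m) + (\<Sum>h\<in>marks m. card (inner_darts h))" using iso(1) by simp
  show "card (hole_darts (canon (glue m u))) = (\<Sum>h\<in>marks m. card (hole_darts (u h)))"
    unfolding iso(2) hole_darts_glue using finite_marks finite_fill by (simp add: card_image card_SigmaI)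
  have "marks (glue m u) = Inr ` (SIGMA h:marks m. marks (u h))" by (simp add: glue_def)
  then show "card (marks (canon (glue m u))) = (\<Sum>h\<in>marks m. card (marks (u h)))"
    unfolding iso(3) using finite_marks finite_fill by (simp add: card_image card_SigmaI)
qed

lemma card_hole_darts: "card (hole_darts m) = (\<Sum>h\<in>marks m. perimeter (u h))"
proof -
  have "card (hole_darts m) = (\<Sum>h\<in>marks m. card (face m h))"
    unfolding hole_darts_def using finite_marks face_self(3)[OF ph(1)] ph(2)
      disjoint_holes[OF QHmaps_proper_holes[OF m]]
    by (intro card_UN_disjoint) auto
  then show ?thesis using perim by simp
qed

lemma full_darts_le: "card (full_darts m) \<le> card (full_darts (canon (glue m u)))"
  using canon_glue_counts(1) by simp

context
  assumes full: "card (full_darts (canon (glue m u))) = card (full_darts m)"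
begin

lemma darts_fill:
  assumes h: "h \<in> marks m"
  shows "darts (u h) = root_face (u h) \<union> hole_darts (u h)"
proof -
  have "(\<Sum>h\<in>marks m. card (inner_darts h)) = 0" using full canon_glue_counts(1) by simp
  then have "card (inner_darts h) = 0" using finite_marks h by simp
  then have "inner_darts h = {}" using finite_fill(1)[OF h] by (simp add: inner_darts_def)
  then show ?thesis
    using root_face_subset(2)[OF phu(1)[OF h]] hole_darts_subset[OF QHmaps_proper_holes[OF u[OF h]]]
    unfolding inner_darts_def by blast
qed

text \<open>The filling has only root-face and hole semi-edges left, and no edge lies between two
  holes, so the other side of a hole is always the root face. This bounds the semi-edges of its
  holes by its perimeter.\<close>

lemma opp_hole_darts:
  assumes h: "h \<in> marks m"
  shows "opp (u h) ` hole_darts (u h) \<subseteq> root_face (u h)" "inj_on (opp (u h)) (hole_darts (u h))"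
proof -
  note pm = planar_mapD[OF phu(1)[OF h]]
  have sub: "hole_darts (u h) \<subseteq> darts (u h)" using darts_fill[OF h] by blast
  then show "opp (u h) ` hole_darts (u h) \<subseteq> root_face (u h)"
    using pm(4) phu(5)[OF h] darts_fill[OF h] by blast
  show "inj_on (opp (u h)) (hole_darts (u h))"
    using pm(6) sub by (intro inj_on_inverseI[of _ "opp (u h)"]) blast
qed

lemma hole_darts_fill_le: "h \<in> marks m \<Longrightarrow> card (hole_darts (u h)) \<le> perimeter (u h)"
  unfolding perimeter_def using opp_hole_darts finite_fill(2) by (meson card_inj_on_le)

lemma hole_darts_le: "card (hole_darts (canon (glue m u))) \<le> card (hole_darts m)"
  unfolding canon_glue_counts(2) card_hole_darts using hole_darts_fill_le by (rule sum_mono)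

context
  assumes hole: "card (hole_darts (canon (glue m u))) = card (hole_darts m)"
begin

lemma opp_root_face:
  assumes h: "h \<in> marks m"
  shows "opp (u h) ` root_face (u h) = hole_darts (u h)" "0 < card (marks (u h))"
proof -
  note pm = planar_mapD[OF phu(1)[OF h]]
  \<comment> \<open>Equal sums of termwise ordered numbers have equal terms, so the injection of the
    hole semi-edges into the root face becomes onto in every filling.\<close>
  have eq: "card (hole_darts (u h)) = card (root_face (u h))"
    using sum_mono_inv[of "\<lambda>h. card (hole_darts (u h))" "marks m" "\<lambda>h. perimeter (u h)",
        OF _ hole_darts_fill_le h finite_marks] hole
    unfolding canon_glue_counts(2) card_hole_darts perimeter_def by simp
  then have "opp (u h) ` hole_darts (u h) = root_face (u h)"
    using card_subset_eq[OF finite_fill(2)[OF h] opp_hole_darts(1)[OF h]]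
      card_image[OF opp_hole_darts(2)[OF h]] by simp
  then have "opp (u h) ` root_face (u h) = (\<lambda>d. opp (u h) (opp (u h) d)) ` hole_darts (u h)"
    by (metis image_image)
  also have "\<dots> = (\<lambda>d. d) ` hole_darts (u h)"
    using pm(6) darts_fill[OF h] by (intro image_cong) auto
  finally show "opp (u h) ` root_face (u h) = hole_darts (u h)" by simp
  then have "marks (u h) \<noteq> {}"
    using root_face_subset(1)[OF phu(1)[OF h]] by (auto simp: hole_darts_def)
  then show "0 < card (marks (u h))" using finite_fill(4)[OF h] by (simp add: card_gt_0_iff)
qed

lemma marks_le: "card (marks m) \<le> card (marks (canon (glue m u)))"
proof -
  have "(\<Sum>h\<in>marks m. 1) \<le> (\<Sum>h\<in>marks m. card (marks (u h)))"
    using opp_root_face(2) by (intro sum_mono) (simp add: Suc_leI)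
  then show ?thesis unfolding canon_glue_counts(3) by simp
qed

text \<open>Every filling has a hole and there are as many holes as fillings, so each has exactly
  one. It is then two-faced, and Euler's relation applies.\<close>

lemma fillings_are_rings:
  assumes K: "card (marks (canon (glue m u))) = card (marks m)" and h: "h \<in> marks m"
  shows "\<exists>k. ring_map (u h) k"
proof -
  have "1 = card (marks (u h))"
    using sum_mono_inv[of "\<lambda>_. 1" "marks m" "\<lambda>h. card (marks (u h))", OF _ _ h finite_marks]
      K opp_root_face(2) unfolding canon_glue_counts(3) by (simp add: Suc_leI)
  then obtain k where mk: "marks (u h) = {k}" by (metis card_1_singletonE)
  have hd: "hole_darts (u h) = face (u h) k" by (simp add: hole_darts_def mk)
  have planar: "planar_map (u h)" using phu(1)[OF h] .
  note pm = planar_mapD[OF planar]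
  have "two_faced (u h) k"
  proof
    fix d assume "d \<in> darts (u h)"
    then show "opp (u h) d \<in> darts (u h) \<and> opp (u h) d \<noteq> d \<and> opp (u h) (opp (u h) d) = d"
      using pm(4-6) by blast
  next
    show "root_face (u h) \<inter> face (u h) k = {}"
      using root_face_hole_darts[OF QHmaps_proper_holes[OF u[OF h]]] hd by simp
  qed (use pm(1-3) mk phu(2)[OF h] darts_fill[OF h] opp_root_face(1)[OF h] hd in simp_all)
  then interpret two_faced "u h" k .
  \<comment> \<open>The root face borders the hole all along, which is the very case in which
    \<open>keeps_mark\<close> prescribes the marked edge.\<close>
  have "opp (u h) k = rootd (u h)"
    using keeps[OF h] mk opp_root_face(1)[OF h] hd unfolding keeps_mark_def by simp
  then have "ring_map (u h) k" using mk nxt_opp_involution[OF planar] by (intro ring_mapI)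
  then show ?thesis by blast
qed

lemma canon_glue_eq:
  assumes "card (marks (canon (glue m u))) = card (marks m)"
  shows "canon (glue m u) = m"
proof -
  obtain k where "\<And>h. h \<in> marks m \<Longrightarrow> ring_map (u h) (k h)"
    using fillings_are_rings[OF assms] by metis
  then have "map_iso m (glue m u)"
    using perim by (intro glue_rings_iso[OF QHmaps_proper_holes[OF m], where k = k])
  then show ?thesis using canon_cong[OF _ ph(1,2)] QHmapsD(4)[OF m] by metis
qed

end

end

end

text \<open>
  Along \<open>\<preceq>\<close> the number of semi-edges outside the holes can only grow; while it stays constant,
  the number of semi-edges in the holes can only decrease; while both stay constant, the number
  of holes can only grow; and if all three stay constant, the fillings are rings.
\<close>

lemma submap_antisym:
  assumes "x \<in> QH" "y \<in> QH" "x \<preceq> y" "y \<preceq> x"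
  shows "x = y"
proof (cases "x = Cemetery \<or> y = Cemetery")
  case True
  then show ?thesis using assms(3,4) by auto
next
  case False
  then obtain m p where xy: "x = Map m" "y = Map p" by (meson hqmap.exhaust)
  then have mp: "m \<in> QHmaps" "p \<in> QHmaps" using assms(1,2) by (auto simp: QH_def)
  obtain u where u: "filling x u p" using assms(3) xy by auto
  obtain v where v: "filling y v m" using assms(4) xy by auto
  interpret U: hole_fillings m u
    using u mp(1) unfolding xy by unfold_locales (auto simp: filling_def)
  interpret V: hole_fillings p v
    using v mp(2) unfolding xy by unfold_locales (auto simp: filling_def)
  have p: "canon (glue m u) = p" and m: "canon (glue p v) = m"
    using u v unfolding xy filling_def by simp_all
  have full: "card (full_darts p) = card (full_darts m)"
    using U.full_darts_le V.full_darts_le unfolding p m by simp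
  have hole: "card (hole_darts p) = card (hole_darts m)"
    using U.hole_darts_le V.hole_darts_le full unfolding p m by simp
  have "card (marks p) = card (marks m)"
    using U.marks_le V.marks_le full hole unfolding p m by simp
  then show ?thesis using U.canon_glue_eq full hole unfolding p xy by simp
qed

section \<open>Stopping maps\<close>

locale stopped_map_filtration =
  fixes M :: "'a measure" and F :: "hqmap \<Rightarrow> 'a measure" and Q :: "'a \<Rightarrow> nat hmap" and S :: "'a \<Rightarrow> hqmap"
  assumes filtration: "map_filtration M F" and stopping: "stopping_map M F Q S"
begin

lemma subalg: "x \<in> QH \<Longrightarrow> subalgebra M (F x)"
  and F_mono: "x \<in> QH \<Longrightarrow> y \<in> QH \<Longrightarrow> x \<preceq> y \<Longrightarrow> sets (F x) \<subseteq> sets (F y)"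
  using filtration unfolding map_filtration_def by blast+

lemma space_F: "x \<in> QH \<Longrightarrow> space (F x) = space M"
  using subalg unfolding subalgebra_def by blast

lemma sets_F: "x \<in> QH \<Longrightarrow> A \<in> sets (F x) \<Longrightarrow> A \<in> sets M"
  using subalg unfolding subalgebra_def by blast

lemma S_QH: "\<omega> \<in> space M \<Longrightarrow> S \<omega> \<in> QH"
  and submap_event: "x \<in> QH \<Longrightarrow> {\<omega>\<in>space M. S \<omega> \<preceq> x} \<in> sets (F x)"
  using stopping unfolding stopping_map_def by blast+

lemma level_event:
  assumes x: "x \<in> QH"
  shows "{\<omega>\<in>space M. S \<omega> = x} \<in> sets (F x)"
proof -
  define Y where "Y = {y\<in>QH. y \<preceq> x \<and> y \<noteq> x}"
  have eq: "{\<omega>\<in>space M. S \<omega> = x} =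
      {\<omega>\<in>space M. S \<omega> \<preceq> x} - (\<Union>y\<in>Y. {\<omega>\<in>space M. S \<omega> \<preceq> y})" (is "?L = ?R")
  proof (intro equalityI subsetI)
    fix \<omega> assume \<omega>: "\<omega> \<in> ?L"
    have "\<not> x \<preceq> y" if "y \<in> Y" for y
      using that submap_antisym[OF x] unfolding Y_def by blast
    then show "\<omega> \<in> ?R" using \<omega> submap_refl[OF x] by auto
  next
    fix \<omega> assume \<omega>: "\<omega> \<in> ?R"
    \<comment> \<open>If \<open>S \<omega>\<close> differed from \<open>x\<close>, it would itself
      be one of the removed indices, and reflexivity would put \<open>\<omega>\<close> in its
      event.\<close>
    then have "S \<omega> \<preceq> S \<omega>" "S \<omega> \<in> QH" using S_QH submap_refl by blast+
    then show "\<omega> \<in> ?L" using \<omega> unfolding Y_def by blast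
  qed
  have "countable Y" by (rule countable_subset[OF _ countable_QH]) (auto simp: Y_def)
  moreover have "{\<omega>\<in>space M. S \<omega> \<preceq> y} \<in> sets (F x)" if "y \<in> Y" for y
    using that submap_event[of y] F_mono[of y x] x unfolding Y_def by blast
  ultimately have "(\<Union>y\<in>Y. {\<omega>\<in>space M. S \<omega> \<preceq> y}) \<in> sets (F x)"
    by (intro sets.countable_UN') auto
  with submap_event[OF x] show ?thesis unfolding eq by (rule sets.Diff)
qed

section \<open>The stopped sigma-algebra and its trace on the levels of the stopping map\<close>

lemma sigma_sets_F: "sigma_algebra (space M) (sigma_sets (space M) (\<Union>x\<in>QH. sets (F x)))"
proof (rule sigma_algebra_sigma_sets)
  show "(\<Union>x\<in>QH. sets (F x)) \<subseteq> Pow (space M)"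
    using sets.sets_into_space space_F by fastforce
qed

lemma sigma_algebra_stopped_events: "sigma_algebra (space M) (stopped_events M F S)"
  unfolding sigma_algebra_iff2
proof (intro conjI ballI allI impI)
  interpret G: sigma_algebra "space M" "sigma_sets (space M) (\<Union>x\<in>QH. sets (F x))"
    by (rule sigma_sets_F)
  show "stopped_events M F S \<subseteq> Pow (space M)"
    using G.sets_into_space unfolding stopped_events_def by blast
  show "{} \<in> stopped_events M F S" unfolding stopped_events_def by simp
  fix A assume A: "A \<in> stopped_events M F S"
  have "(space M - A) \<inter> {\<omega>\<in>space M. S \<omega> \<preceq> x} \<in> sets (F x)" if x: "x \<in> QH" for x
  proof -
    have "(space M - A) \<inter> {\<omega>\<in>space M. S \<omega> \<preceq> x} =
        {\<omega>\<in>space M. S \<omega> \<preceq> x} - A \<inter> {\<omega>\<in>space M. S \<omega> \<preceq> x}" by blast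
    then show ?thesis using A x submap_event[OF x] unfolding stopped_events_def by (simp add: sets.Diff)
  qed
  then show "space M - A \<in> stopped_events M F S"
    using A G.compl_sets unfolding stopped_events_def by blast
next
  interpret G: sigma_algebra "space M" "sigma_sets (space M) (\<Union>x\<in>QH. sets (F x))"
    by (rule sigma_sets_F)
  fix A :: "nat \<Rightarrow> 'a set" assume A: "range A \<subseteq> stopped_events M F S"
  have "(\<Union>i. A i) \<inter> {\<omega>\<in>space M. S \<omega> \<preceq> x} \<in> sets (F x)" if x: "x \<in> QH" for x
  proof -
    have "A i \<inter> {\<omega>\<in>space M. S \<omega> \<preceq> x} \<in> sets (F x)" for i
      using A x unfolding stopped_events_def by blast
    then have "(\<Union>i. A i \<inter> {\<omega>\<in>space M. S \<omega> \<preceq> x}) \<in> sets (F x)" by blast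
    then show ?thesis by (simp add: Int_UN_distrib2)
  qed
  moreover have "(\<Union>i. A i) \<in> sigma_sets (space M) (\<Union>x\<in>QH. sets (F x))"
    using A unfolding stopped_events_def by (intro G.countable_UN) blast
  ultimately show "(\<Union>i. A i) \<in> stopped_events M F S" unfolding stopped_events_def by blast
qed

lemma sets_stopped_algebra: "sets (stopped_algebra M F S) = stopped_events M F S"
  unfolding stopped_algebra_def using sigma_algebra_stopped_events by (rule sigma_algebra.sets_measure_of_eq)

lemma stopped_subalgebra: "subalgebra M (stopped_algebra M F S)"
proof -
  have "sigma_sets (space M) (\<Union>x\<in>QH. sets (F x)) \<subseteq> sets M"
    using sets_F by (intro sets.sigma_sets_subset) blast
  then have "stopped_events M F S \<subseteq> sets M" unfolding stopped_events_def by blast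
  then show ?thesis unfolding subalgebra_def sets_stopped_algebra
    by (simp add: stopped_algebra_def space_measure_of_conv)
qed

text \<open>On \<open>{S = x}\<close> the condition \<open>S \<omega> \<preceq> y\<close> reads
  \<open>x \<preceq> y\<close> and no longer depends on \<open>\<omega>\<close>, so each
  intersection is the whole level or empty.\<close>

lemma level_stopped:
  assumes x: "x \<in> QH"
  shows "{\<omega>\<in>space M. S \<omega> = x} \<in> sets (stopped_algebra M F S)"
proof -
  have "{\<omega>\<in>space M. S \<omega> = x} \<inter> {\<omega>\<in>space M. S \<omega> \<preceq> y} \<in> sets (F y)" if y: "y \<in> QH" for y
  proof (cases "x \<preceq> y")
    case True
    then have "{\<omega>\<in>space M. S \<omega> = x} \<inter> {\<omega>\<in>space M. S \<omega> \<preceq> y} = {\<omega>\<in>space M. S \<omega> = x}" by blast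
    then show ?thesis using level_event[OF x] F_mono[OF x y True] by auto
  next
    case False
    then have "{\<omega>\<in>space M. S \<omega> = x} \<inter> {\<omega>\<in>space M. S \<omega> \<preceq> y} = {}" by blast
    then show ?thesis by simp
  qed
  moreover have "{\<omega>\<in>space M. S \<omega> = x} \<in> sigma_sets (space M) (\<Union>x\<in>QH. sets (F x))"
    using level_event[OF x] x by (intro sigma_sets.Basic) blast
  ultimately show ?thesis unfolding sets_stopped_algebra stopped_events_def by blast
qed

lemma stopped_Int_level:
  assumes "A \<in> sets (stopped_algebra M F S)" and x: "x \<in> QH"
  shows "A \<inter> {\<omega>\<in>space M. S \<omega> = x} \<in> sets (F x)"
proof -
  have "A \<inter> {\<omega>\<in>space M. S \<omega> \<preceq> x} \<in> sets (F x)"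
    using assms unfolding sets_stopped_algebra stopped_events_def by blast
  then have "(A \<inter> {\<omega>\<in>space M. S \<omega> \<preceq> x}) \<inter> {\<omega>\<in>space M. S \<omega> = x} \<in> sets (F x)"
    using level_event[OF x] by (rule sets.Int)
  moreover have "(A \<inter> {\<omega>\<in>space M. S \<omega> \<preceq> x}) \<inter> {\<omega>\<in>space M. S \<omega> = x} = A \<inter> {\<omega>\<in>space M. S \<omega> = x}"
    using submap_refl[OF x] by blast
  ultimately show ?thesis by simp
qed

text \<open>
  On \<open>{S = x}\<close> the stopped algebra and \<open>F x\<close> have the same trace, so conditional expectations
  given them agree there.
\<close>

lemma cond_exp_on_level:
  fixes B :: "hqmap \<Rightarrow> (nat \<Rightarrow> nat hmap) set"
  assumes "prob_space M" and boltzmann: "filtered_boltzmann_map M F q l Q" and x: "x \<in> QH"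
  shows "AE \<omega> in M. S \<omega> = x \<longrightarrow>
      real_cond_exp M (stopped_algebra M F S)
        (indicator {\<omega>\<in>space M. fillings (S \<omega>) (Q \<omega>) \<in> B (S \<omega>)}) \<omega> =
      measure_pmf.prob (boltzmann_family q l x) (B x)"
proof -
  interpret prob_space M by fact
  interpret G: finite_measure_subalgebra M "stopped_algebra M F S"
    using stopped_subalgebra by unfold_locales
  interpret Fx: finite_measure_subalgebra M "F x"
    using subalg[OF x] by unfold_locales
  define L where "L = (\<lambda>x. {\<omega>\<in>space M. S \<omega> = x})"
  define E where "E = {\<omega>\<in>space M. fillings (S \<omega>) (Q \<omega>) \<in> B (S \<omega>)}"
  define D where "D = (\<lambda>x. {\<omega>\<in>space M. fillings x (Q \<omega>) \<in> B x})"
  define p where "p = measure_pmf.prob (boltzmann_family q l x) (B x)"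
  have Q: "Q \<in> measurable M (count_space UNIV)"
    using boltzmann by (simp add: filtered_boltzmann_map_def boltzmann_map_def)
  have L: "L y \<in> sets M" if "y \<in> QH" for y
    using sets_F[OF that level_event[OF that]] by (simp add: L_def)
  have D: "D y \<in> sets M" for y
  proof -
    have "D y = Q -` {q. fillings y q \<in> B y} \<inter> space M" by (auto simp: D_def)
    also have "\<dots> \<in> sets M" using Q by (rule measurable_sets) simp
    finally show ?thesis .
  qed
  \<comment> \<open>Measurability of an event with the random map \<open>S\<close> in it comes from
    cutting it along the countably many values of \<open>S\<close>.\<close>
  have "E = (\<Union>y\<in>QH. L y \<inter> D y)" using S_QH by (auto simp: E_def L_def D_def)
  also have "\<dots> \<in> sets M" using L D countable_QH by (intro sets.countable_UN') auto
  finally have E: "E \<in> sets M" .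
  \<comment> \<open>Restricting to the level replaces the random map \<open>S\<close> by the fixed
    map \<open>x\<close>.\<close>
  have eq: "(\<lambda>\<omega>. indicator (L x) \<omega> * indicator E \<omega> :: real) = indicator (L x \<inter> D x)"
    by (auto simp: fun_eq_iff L_def E_def D_def split: split_indicator)
  have LG: "L x \<in> sets (stopped_algebra M F S)" using level_stopped[OF x] by (simp add: L_def)
  have "AE \<omega> in M. real_cond_exp M (stopped_algebra M F S) (\<lambda>\<omega>. indicator (L x) \<omega> * indicator E \<omega>) \<omega>
      = indicator (L x) \<omega> * real_cond_exp M (stopped_algebra M F S) (indicator E) \<omega>"
  proof (rule G.real_cond_exp_mult)
    show "integrable M (\<lambda>\<omega>. indicator (L x) \<omega> * indicator E \<omega> :: real)"
      unfolding eq using L[OF x] D by (intro integrable_real_indicator) (auto simp: emeasure_eq_measure)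
  qed (use LG E in auto)
  moreover have "AE \<omega> in M. real_cond_exp M (stopped_algebra M F S) (\<lambda>\<omega>. indicator (L x) \<omega> * indicator E \<omega>) \<omega>
      = p * indicator (L x) \<omega>"
    unfolding eq
  proof (rule G.real_cond_exp_charact)
    fix A assume A: "A \<in> sets (stopped_algebra M F S)"
    \<comment> \<open>This turns a test event of the stopped algebra into one of \<open>F x\<close>,
      against which the conditional expectation given \<open>F x\<close> may be integrated.\<close>
    have AL: "A \<inter> L x \<in> sets (F x)" using stopped_Int_level[OF A x] by (simp add: L_def)
    have "(\<integral>\<omega>\<in>A. indicator (L x \<inter> D x) \<omega> \<partial>M) = (\<integral>\<omega>\<in>A \<inter> L x. indicator (D x) \<omega> \<partial>M)"
      unfolding set_lebesgue_integral_def
      by (intro Bochner_Integration.integral_cong) (auto split: split_indicator)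
    also have "\<dots> = (\<integral>\<omega>\<in>A \<inter> L x. real_cond_exp M (F x) (indicator (D x)) \<omega> \<partial>M)"
      using D[of x] AL by (intro Fx.real_cond_exp_intA integrable_real_indicator) (auto simp: emeasure_eq_measure)
    also have "\<dots> = (\<integral>\<omega>\<in>A \<inter> L x. p \<partial>M)"
    proof -
      have "AE \<omega> in M. x \<preceq> Map (Q \<omega>) \<longrightarrow> real_cond_exp M (F x) (indicator (D x)) \<omega> = p"
        using boltzmann x unfolding filtered_boltzmann_map_def D_def p_def by blast
      moreover have "AE \<omega> in M. S \<omega> \<preceq> Map (Q \<omega>)" using stopping by (simp add: stopping_map_def)
      \<comment> \<open>The Boltzmann property speaks only where
        \<open>x \<preceq> Map (Q \<omega>)\<close>; on \<open>L x\<close> this is the almost sure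
        inclusion of \<open>S\<close> in \<open>Q\<close>.\<close>
      ultimately have "AE \<omega> in M. \<omega> \<in> A \<inter> L x \<longrightarrow> real_cond_exp M (F x) (indicator (D x)) \<omega> = p"
        by eventually_elim (auto simp: L_def)
      then show ?thesis using sets_F[OF x AL]
        by (intro set_lebesgue_integral_cong_AE) auto
    qed
    also have "\<dots> = (\<integral>\<omega>\<in>A. p * indicator (L x) \<omega> \<partial>M)"
      unfolding set_lebesgue_integral_def
      by (intro Bochner_Integration.integral_cong) (auto split: split_indicator)
    finally show "(\<integral>\<omega>\<in>A. indicator (L x \<inter> D x) \<omega> \<partial>M) = (\<integral>\<omega>\<in>A. p * indicator (L x) \<omega> \<partial>M)" .
  qed (use L[OF x] D[of x] LG in \<open>auto simp: emeasure_eq_measure\<close>)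
  ultimately have "AE \<omega> in M. indicator (L x) \<omega> * real_cond_exp M (stopped_algebra M F S) (indicator E) \<omega>
      = p * indicator (L x) \<omega>"
    by eventually_elim metis
  then have "AE \<omega> in M. S \<omega> = x \<longrightarrow> real_cond_exp M (stopped_algebra M F S) (indicator E) \<omega> = p"
    using AE_space by eventually_elim (auto simp: L_def)
  then show ?thesis unfolding E_def p_def .
qed

end

lemma filling_fillings:
  assumes "x \<preceq> Map p"
  shows "filling x (fillings x p) p"
  using assms unfolding fillings_def by (metis submap.simps(2) someI_ex)

text \<open>The set of holes is random, so a test set \<open>B x\<close> is chosen for every value
  \<open>x\<close> of \<open>S\<close>. Quantifying over all such \<open>B\<close> says that the
  conditional law of the fillings is the product law
  \<open>boltzmann_family q l (S \<omega>)\<close>, which contains the independence.\<close>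

theorem theorem3p15:
  fixes M :: "'a measure" and F :: "hqmap \<Rightarrow> 'a measure" and q :: real and l :: nat
    and Q :: "'a \<Rightarrow> nat hmap" and S :: "'a \<Rightarrow> hqmap"
  assumes "prob_space M"
    and "0 < q" and "\<And>k. (\<lambda>m. q ^ card (inner_faces m)) summable_on Qb k"
    and "map_filtration M F"
    and "filtered_boltzmann_map M F q l Q"
    and "stopping_map M F Q S"
  shows "(AE \<omega> in M. filling (S \<omega>) (fillings (S \<omega>) (Q \<omega>)) (Q \<omega>) \<and>
                      Q \<omega> = S \<omega> \<odot> fillings (S \<omega>) (Q \<omega>)) \<and>
         (\<forall>B :: hqmap \<Rightarrow> (nat \<Rightarrow> nat hmap) set. AE \<omega> in M.
            real_cond_exp M (stopped_algebra M F S)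
              (indicator {\<omega>\<in>space M. fillings (S \<omega>) (Q \<omega>) \<in> B (S \<omega>)}) \<omega> =
            measure_pmf.prob (boltzmann_family q l (S \<omega>)) (B (S \<omega>)))"
proof (intro conjI allI)
  interpret stopped_map_filtration M F Q S using assms(4,6) by unfold_locales
  have "AE \<omega> in M. S \<omega> \<preceq> Map (Q \<omega>)" using assms(6) by (simp add: stopping_map_def)
  then show "AE \<omega> in M. filling (S \<omega>) (fillings (S \<omega>) (Q \<omega>)) (Q \<omega>) \<and>
      Q \<omega> = S \<omega> \<odot> fillings (S \<omega>) (Q \<omega>)"
  proof eventually_elim
    case (elim \<omega>)
    show ?case using filling_fillings[OF elim] by (simp add: filling_def)
  qed
  fix B :: "hqmap \<Rightarrow> (nat \<Rightarrow> nat hmap) set"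
  \<comment> \<open>The exceptional null set depends on \<open>x\<close>; countability of
    \<open>QH\<close> allows one null set for all values, after which \<open>x\<close> can be set to
    \<open>S \<omega>\<close>.\<close>
  have "AE \<omega> in M. \<forall>x\<in>QH. S \<omega> = x \<longrightarrow>
      real_cond_exp M (stopped_algebra M F S)
        (indicator {\<omega>\<in>space M. fillings (S \<omega>) (Q \<omega>) \<in> B (S \<omega>)}) \<omega> =
      measure_pmf.prob (boltzmann_family q l x) (B x)"
    unfolding AE_ball_countable[OF countable_QH] using cond_exp_on_level[OF assms(1,5)] by blast
  then show "AE \<omega> in M. real_cond_exp M (stopped_algebra M F S)
        (indicator {\<omega>\<in>space M. fillings (S \<omega>) (Q \<omega>) \<in> B (S \<omega>)}) \<omega> =
      measure_pmf.prob (boltzmann_family q l (S \<omega>)) (B (S \<omega>))"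
    using AE_space by eventually_elim (use S_QH in blast)
qed

end
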